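(* (Mean-square convergence.) Suppose Assumption 1 (i.a), (ii.a), (ii.b), (ii.c) and (iii.a) hold, with the same $\delta\in[0,1/2)$ in (ii.c) and (iii.a). Then the estimation error $e_0(t)=X(t)-\mathbf{1}_N\otimes\theta$ of the event-triggered distributed estimation algorithm satisfies $$\lim_{t\to\infty}\frac{\mathbb{E}\{\|e_0(t)\|^2\}}{\alpha^{2\delta}(t)}=0.$$
   Context: Graph: $\mathcal{G}$ is a weighted digraph on $\mathcal{V}=\{1,\dots,N\}$ with adjacency matrix $\mathcal{A}=[a_{i,j}]$, $a_{i,j}\ge0$, $a_{i,i}=0$; $a_{i,j}>0$ means a link from $j$ to $i$. $\mathcal{N}_i=\{j:a_{i,j}>0\}$ (parents of $i$), $\mathcal{N}_i^c=\{j:a_{j,i}>0\}$ (children of $i$). Laplacian $\mathcal{L}=\mathcal{D}-\mathcal{A}$, $\mathcal{D}=\mathrm{diag}\{\sum_ja_{1,j},\dots,\sum_j a_{N,j}\}$, $\bar{\mathcal{L}}=(\mathcal{L}+\mathcal{L}^{\sf T})/2$. Model: unknown $\theta\in\mathbb{R}^M$; sensor $i$ measures $y_i(t)=H_i(t)\theta+v_i(t)$, $H_i(t)\in\mathbb{R}^{m_i\times M}$ known (random), $v_i(t)\in\mathbb{R}^{m_i}$ noise. $\bar D_H(t)=\mathrm{blockdiag}\{H_1^{\sf T}(t),\dots,H_N^{\sf T}(t)\}$, $V(t)=[v_1^{\sf T}(t),\dots,v_N^{\sf T}(t)]^{\sf T}$, $\mathcal{F}(t)=\sigma(\bar D_H(s),V(s),0\le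 s\le t)$, $\mathcal{F}(-1)=\{\emptyset,\Omega\}$. Algorithm: each sensor $i$ has a deterministic fixed initial estimate $x_i(0)\in\mathbb{R}^M$, deterministic step sizes $\alpha_i(t)>0$ and thresholds $f_i(t)\ge0$. Let $\hat x_i(t)$ denote the last estimate sent by sensor $i$ up to time $t$: $\hat x_i(0)=x_i(0)$ (sensor $i$ sends at $t=0$), and for $t\ge1$, if $\|x_i(t)-\hat x_i(t-1)\|>f_i(t)$ then sensor $i$ sends (an event is triggered) and $\hat x_i(t)=x_i(t)$, otherwise $\hat x_i(t)=\hat x_i(t-1)$. The update is $$x_i(t+1)=x_i(t)+\alpha_i(t)H_i^{\sf T}(t)(y_i(t)-H_i(t)x_i(t))+\alpha_i(t)\sum_{j\in\mathcal{N}_i}a_{i,j}(\hat x_j(t)-x_i(t)).$$ $X(t)=[x_1^{\sf T}(t),\dots,x_N^{\sf T}(t)]^{\sf T}$; $f_{\max}(t)=\max_i f_i(t)$, $f_{\min}(t)=\min_i f_i(t)$. Assumption 1: (i.a) there is a deterministic sequence $\{\alpha(t)\}$ with $\alpha_i(t)/\alpha(t)\to1$ for all $i$, $\alpha(t)>0$, $\alpha(t)\to0$, $\sum_t\alpha(t)=\infty$, and $1/\alpha(t+1)-1/\alpha(t)\to\alpha_0\ge0$. (i.b) $\sum_{t}\alpha(t)^{2(1-\delta)}<\infty$ for some $\delta\in[0,1/2)$. (ii.a) $\{\bar D_H(t)\}$ and $\{V(t)\}$ are independent sequences. (ii.b) $\{V(t)\}$ is a martingale difference sequence w.r.t. $\{\mathcal{F}(t)\}$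 and for some $\rho>2$, $\sup_t\mathbb{E}\{\|V(t)\|^\rho\mid\mathcal{F}(t-1)\}=c_V<\infty$ a.s. (ii.c) $\sup_t\|\bar D_H(t)\|^2\le D<\infty$ a.s., and there exist $h\in\mathbb{N}^+$, $\lambda>0$ such that for all $m\in\mathbb{N}$ and some $\delta\in[0,1/2)$, $\lambda_{\min}\big[\sum_{t=mh}^{(m+1)h-1}\mathbb{E}\{\bar{\mathcal{L}}\otimes I_M+\bar D_H(t)\bar D_H^{\sf T}(t)\mid\mathcal{F}(mh-1)\}\big]\ge\lambda+h\alpha_0\delta$ a.s. (iii.a) $f_{\max}(t)/\alpha^\delta(t)\to0$ for some $\delta\in[0,1/2)$. (iii.b) $\sum_t\alpha(t)^{1-\delta}f_{\max}(t)<\infty$ for some $\delta\in[0,1/2)$. *)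

theory Defs
  imports "HOL-Probability.Probability"
begin

(* Vectors in R^n are functions nat => real, only indices < n matter.
   Sensors are indexed 0..N-1, coordinates 0..M-1, rows of H_i are 0..m i - 1. *)

definition vnorm :: "nat \<Rightarrow> (nat \<Rightarrow> real) \<Rightarrow> real" where
  "vnorm n x = sqrt (\<Sum>k<n. (x k)^2)"

definition est_update :: "nat \<Rightarrow> nat \<Rightarrow> (nat \<Rightarrow> nat) \<Rightarrow> (nat \<Rightarrow> nat \<Rightarrow> real)
    \<Rightarrow> (nat \<Rightarrow> real) \<Rightarrow> (nat \<Rightarrow> nat \<Rightarrow> nat \<Rightarrow> real) \<Rightarrow> (nat \<Rightarrow> nat \<Rightarrow> real)
    \<Rightarrow> (nat \<Rightarrow> nat \<Rightarrow> real) \<Rightarrow> (nat \<Rightarrow> nat \<Rightarrow> real) \<Rightarrow> (nat \<Rightarrow> nat \<Rightarrow> real)" where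
  "est_update N M m a al Ht yt x xh = (\<lambda>i k.
      x i k + al i * (\<Sum>r<m i. Ht i r k * (yt i r - (\<Sum>c<M. Ht i r c * x i c)))
            + al i * (\<Sum>j\<in>{j. j < N \<and> a i j > 0}. a i j * (xh j k - x i k)))"

(* state (x(t), xhat(t)); arguments: al i t = alpha_i(t), f i t = f_i(t),
   H t i r c = entry (r,c) of H_i(t), y t i r = entry r of y_i(t), x0 i = x_i(0) *)
primrec est_state :: "nat \<Rightarrow> nat \<Rightarrow> (nat \<Rightarrow> nat) \<Rightarrow> (nat \<Rightarrow> nat \<Rightarrow> real)
    \<Rightarrow> (nat \<Rightarrow> nat \<Rightarrow> real) \<Rightarrow> (nat \<Rightarrow> nat \<Rightarrow> real)
    \<Rightarrow> (nat \<Rightarrow> nat \<Rightarrow> nat \<Rightarrow> nat \<Rightarrow> real) \<Rightarrow> (nat \<Rightarrow> nat \<Rightarrow> nat \<Rightarrow> real)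
    \<Rightarrow> (nat \<Rightarrow> nat \<Rightarrow> real) \<Rightarrow> nat \<Rightarrow> (nat \<Rightarrow> nat \<Rightarrow> real) \<times> (nat \<Rightarrow> nat \<Rightarrow> real)" where
  "est_state N M m a al f H y x0 0 = (x0, x0)"
| "est_state N M m a al f H y x0 (Suc t) =
     (let xt = fst (est_state N M m a al f H y x0 t);
          xh = snd (est_state N M m a al f H y x0 t);
          xn = est_update N M m a (\<lambda>i. al i t) (H t) (y t) xt xh
      in (xn, \<lambda>i. if vnorm M (\<lambda>k. xn i k - xh i k) > f i (Suc t) then xn i else xh i))"

definition est_x :: "nat \<Rightarrow> nat \<Rightarrow> (nat \<Rightarrow> nat) \<Rightarrow> (nat \<Rightarrow> nat \<Rightarrow> real)
    \<Rightarrow> (nat \<Rightarrow> nat \<Rightarrow> real) \<Rightarrow> (nat \<Rightarrow> nat \<Rightarrow> real)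
    \<Rightarrow> ('w \<Rightarrow> nat \<Rightarrow> nat \<Rightarrow> nat \<Rightarrow> nat \<Rightarrow> real) \<Rightarrow> ('w \<Rightarrow> nat \<Rightarrow> nat \<Rightarrow> nat \<Rightarrow> real)
    \<Rightarrow> (nat \<Rightarrow> real) \<Rightarrow> (nat \<Rightarrow> nat \<Rightarrow> real) \<Rightarrow> 'w \<Rightarrow> nat \<Rightarrow> nat \<Rightarrow> nat \<Rightarrow> real" where
  "est_x N M m a al f H v \<theta> x0 \<omega> t =
     fst (est_state N M m a al f (H \<omega>) (\<lambda>s i r. (\<Sum>c<M. H \<omega> s i r c * \<theta> c) + v \<omega> s i r) x0 t)"

definition rv_sigma :: "'w measure \<Rightarrow> ('w \<Rightarrow> real) set \<Rightarrow> 'w measure" where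
  "rv_sigma P Xs = sigma (space P) (\<Union>X\<in>Xs. {X -` B \<inter> space P | B. B \<in> sets borel})"

definition H_rvs :: "nat \<Rightarrow> nat \<Rightarrow> (nat \<Rightarrow> nat) \<Rightarrow> ('w \<Rightarrow> nat \<Rightarrow> nat \<Rightarrow> nat \<Rightarrow> nat \<Rightarrow> real)
    \<Rightarrow> (nat \<Rightarrow> bool) \<Rightarrow> ('w \<Rightarrow> real) set" where
  "H_rvs N M m H S = {(\<lambda>\<omega>. H \<omega> s i r c) | s i r c. S s \<and> i < N \<and> r < m i \<and> c < M}"

definition V_rvs :: "nat \<Rightarrow> (nat \<Rightarrow> nat) \<Rightarrow> ('w \<Rightarrow> nat \<Rightarrow> nat \<Rightarrow> nat \<Rightarrow> real)
    \<Rightarrow> (nat \<Rightarrow> bool) \<Rightarrow> ('w \<Rightarrow> real) set" where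
  "V_rvs N m v S = {(\<lambda>\<omega>. v \<omega> s i r) | s i r. S s \<and> i < N \<and> r < m i}"

(* filtr ... n = F(n-1) = sigma(Dbar_H(s), V(s), 0 <= s <= n-1);  filtr ... 0 = F(-1) = {{}, Omega} *)
definition filtr :: "'w measure \<Rightarrow> nat \<Rightarrow> nat \<Rightarrow> (nat \<Rightarrow> nat) \<Rightarrow> ('w \<Rightarrow> nat \<Rightarrow> nat \<Rightarrow> nat \<Rightarrow> nat \<Rightarrow> real)
    \<Rightarrow> ('w \<Rightarrow> nat \<Rightarrow> nat \<Rightarrow> nat \<Rightarrow> real) \<Rightarrow> nat \<Rightarrow> 'w measure" where
  "filtr P N M m H v n = rv_sigma P (H_rvs N M m H (\<lambda>s. s < n) \<union> V_rvs N m v (\<lambda>s. s < n))"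

definition V_norm :: "nat \<Rightarrow> (nat \<Rightarrow> nat) \<Rightarrow> (nat \<Rightarrow> nat \<Rightarrow> real) \<Rightarrow> real" where
  "V_norm N m vt = sqrt (\<Sum>i<N. \<Sum>r<m i. (vt i r)^2)"

definition offs :: "(nat \<Rightarrow> nat) \<Rightarrow> nat \<Rightarrow> nat" where
  "offs m i = (\<Sum>j<i. m j)"

(* Dbar_H = blockdiag{H_1^T,...,H_N^T}, size (N*M) x (offs m N); row i*M+k, column offs m i + r *)
definition DH :: "nat \<Rightarrow> nat \<Rightarrow> (nat \<Rightarrow> nat) \<Rightarrow> (nat \<Rightarrow> nat \<Rightarrow> nat \<Rightarrow> real) \<Rightarrow> nat \<Rightarrow> nat \<Rightarrow> real" where
  "DH N M m Ht p q = (if p < N * M \<and> offs m (p div M) \<le> q \<and> q < offs m (p div M) + m (p div M)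
                      then Ht (p div M) (q - offs m (p div M)) (p mod M) else 0)"

definition mat_norm :: "nat \<Rightarrow> nat \<Rightarrow> (nat \<Rightarrow> nat \<Rightarrow> real) \<Rightarrow> real" where
  "mat_norm nr nc A = Sup {vnorm nr (\<lambda>p. \<Sum>q<nc. A p q * x q) | x. vnorm nc x \<le> 1}"

definition lap :: "nat \<Rightarrow> (nat \<Rightarrow> nat \<Rightarrow> real) \<Rightarrow> nat \<Rightarrow> nat \<Rightarrow> real" where
  "lap N a i j = (if i = j then (\<Sum>l<N. a i l) else 0) - a i j"

definition lapbar :: "nat \<Rightarrow> (nat \<Rightarrow> nat \<Rightarrow> real) \<Rightarrow> nat \<Rightarrow> nat \<Rightarrow> real" where
  "lapbar N a i j = (lap N a i j + lap N a j i) / 2"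

(* Lbar (x) I_M + Dbar_H Dbar_H^T, size (N*M) x (N*M) *)
definition Qmat :: "nat \<Rightarrow> nat \<Rightarrow> (nat \<Rightarrow> nat) \<Rightarrow> (nat \<Rightarrow> nat \<Rightarrow> real) \<Rightarrow> (nat \<Rightarrow> nat \<Rightarrow> nat \<Rightarrow> real)
    \<Rightarrow> nat \<Rightarrow> nat \<Rightarrow> real" where
  "Qmat N M m a Ht p p' = lapbar N a (p div M) (p' div M) * (if p mod M = p' mod M then 1 else 0)
        + (\<Sum>q<offs m N. DH N M m Ht p q * DH N M m Ht p' q)"

definition lambda_min :: "nat \<Rightarrow> (nat \<Rightarrow> nat \<Rightarrow> real) \<Rightarrow> real" where
  "lambda_min n S = Min {l. \<exists>x. (\<exists>p<n. x p \<noteq> 0) \<and> (\<forall>p<n. (\<Sum>q<n. S p q * x q) = l * x p)}"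

end

theory Submission
  imports Defs
begin

text \<open>
  Stacking the estimation errors as \<open>e\<close>, the algorithm reads
  \<open>e (t + 1) = e t + A t (w t + u t - G t e t)\<close>, where \<open>A t\<close> holds the step sizes, the symmetric part of
  \<open>G t\<close> is the matrix of condition (ii.c), the event error satisfies \<open>w t = O(f\<^sub>m\<^sub>a\<^sub>x t)\<close>, and the
  noise term \<open>u t\<close> is uncorrelated with \<open>e t\<close>. Over a block of \<open>h\<close> steps \<open>e\<close> moves
  by \<open>O(\<alpha>)\<close> in mean square, so \<open>e t\<close> may be frozen at the start \<open>s\<close> of the block in the quadratic form;
  since \<open>e s\<close> is measurable with respect to the past, (ii.c) applies and the mean square contracts by the factor
  \<open>1 - 2 \<alpha> (\<lambda> + h \<alpha>\<^sub>0 \<delta>) + o(\<alpha>)\<close>. Dividing by \<open>\<alpha>\<close> to the power \<open>2 \<delta>\<close> costs a factor \<open>1 + 2 \<alpha> h \<alpha>\<^sub>0 \<delta> + o(\<alpha>)\<close>,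
  so the contraction \<open>1 - 2 \<alpha> \<lambda> + o(\<alpha>)\<close> remains, while the noise and event contributions are \<open>o(\<alpha>)\<close>.
\<close>

section \<open>A scalar recursion\<close>

text \<open>The noise term multiplies \<open>v\<close> at time \<open>t\<close> by \<open>H\<close>
  of the same time, which the filtration up to \<open>t - 1\<close> does not contain; the martingale
  property alone therefore does not make it uncorrelated with the error. Independence of the two
  sequences repairs this: \<open>v\<close> at time \<open>t\<close> stays centred when all
  observation matrices are added to the conditioning, which is the purpose of \<open>past\<close>.
  Since \<open>h\<close> is fixed, drift constants may grow exponentially in \<open>h\<close>. The
  bound \<open>2 * \<delta> < 1\<close> acts twice: a power with this exponent is concave, so the
  change of normalisation can be linearised, and noise of order \<open>\<alpha>\<^sup>2\<close> per
  step remains negligible after normalisation. \<open>lambda_min\<close> is the least element of a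
  set of eigenvalues, so its relation to quadratic forms has to be derived by minimising the form on
  the unit sphere.\<close>

lemma stochastic_approximation_recursion:
  fixes U b g :: "nat \<Rightarrow> real"
  assumes lam: "lam > 0" and U: "\<And>k. U k \<ge> 0" and b: "\<And>k. b k \<ge> 0" and "b \<longlonglongrightarrow> 0"
    and div: "\<not> summable b" and "g \<longlonglongrightarrow> 0"
    and rec: "\<forall>\<^sub>F k in sequentially. U (Suc k) \<le> (1 - lam * b k) * U k + b k * g k"
  shows "U \<longlonglongrightarrow> 0"
proof (rule order_tendstoI)
  fix y :: real assume "y < 0"
  then show "\<forall>\<^sub>F k in sequentially. y < U k" using U by (auto intro: always_eventually less_le_trans)
next
  fix y :: real assume y: "0 < y"
  have "\<forall>\<^sub>F k in sequentially. g k < lam * (y / 2)"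
    using \<open>g \<longlonglongrightarrow> 0\<close> lam y by (intro order_tendstoD) auto
  moreover have "\<forall>\<^sub>F k in sequentially. b k < 1 / lam"
    using \<open>b \<longlonglongrightarrow> 0\<close> lam by (intro order_tendstoD) auto
  ultimately have "\<forall>\<^sub>F k in sequentially. U (Suc k) \<le> (1 - lam * b k) * U k + b k * g k
      \<and> g k < lam * (y / 2) \<and> b k < 1 / lam"
    using rec by eventually_elim auto
  then obtain k0 where k0: "\<And>k. k \<ge> k0 \<Longrightarrow> U (Suc k) \<le> (1 - lam * b k) * U k + b k * g k
      \<and> g k < lam * (y / 2) \<and> b k < 1 / lam"
    unfolding eventually_sequentially by blast
  \<comment> \<open>From time \<open>k0\<close> on, \<open>b * g\<close> is at most
    \<open>lam * b * (y / 2)\<close>, so the excess of \<open>U\<close> over the level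
    \<open>y / 2\<close> obeys the recursion without its inhomogeneous term. Cut off at 0, it decays
    like \<open>exp (- lam * S k)\<close>, and \<open>S\<close> is unbounded because
    \<open>b\<close> is not summable.\<close>
  define V where "V k = max 0 (U (k + k0) - y / 2)" for k
  define S where "S k = (\<Sum>j<k. b (j + k0))" for k
  have step: "V (Suc k) \<le> exp (- lam * b (k + k0)) * V k" for k
  proof -
    have *: "U (Suc (k + k0)) \<le> (1 - lam * b (k + k0)) * U (k + k0) + b (k + k0) * g (k + k0)"
      "g (k + k0) < lam * (y / 2)" "b (k + k0) < 1 / lam" using k0[of "k + k0"] by auto
    have c: "0 \<le> 1 - lam * b (k + k0)" using *(3) lam by (simp add: field_simps)
    have "b (k + k0) * g (k + k0) \<le> b (k + k0) * (lam * (y / 2))"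
      using *(2) b by (intro mult_left_mono) auto
    then have "U (Suc (k + k0)) - y / 2 \<le> (1 - lam * b (k + k0)) * (U (k + k0) - y / 2)"
      using *(1) by (simp add: algebra_simps)
    also have "\<dots> \<le> (1 - lam * b (k + k0)) * V k"
      using c by (intro mult_left_mono) (auto simp: V_def)
    finally have "V (Suc k) \<le> (1 - lam * b (k + k0)) * V k"
      using c by (auto simp: V_def)
    also have "\<dots> \<le> exp (- lam * b (k + k0)) * V k"
      using exp_ge_add_one_self[of "- lam * b (k + k0)"] by (intro mult_right_mono) (auto simp: V_def)
    finally show ?thesis .
  qed
  have V: "V k \<le> exp (- lam * S k) * V 0" for k
  proof (induction k)
    case (Suc k)
    have "V (Suc k) \<le> exp (- lam * b (k + k0)) * (exp (- lam * S k) * V 0)"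
      using step[of k] Suc by (meson exp_ge_zero mult_left_mono order_trans)
    then show ?case by (simp add: S_def exp_add[symmetric] mult.assoc[symmetric] algebra_simps)
  qed (simp add: S_def)
  \<comment> \<open>\<open>V 0\<close> may vanish; \<open>V 0 + 1\<close> gives the logarithm a
    positive argument.\<close>
  have V0: "0 < (V 0 + 1) / (y / 2)" using y by (intro divide_pos_pos) (auto simp: V_def)
  have "\<exists>k. S k > B" for B
  proof (rule ccontr)
    assume "\<nexists>k. S k > B"
    then have "summable (\<lambda>j. b (j + k0))"
      using b by (intro summableI_nonneg_bounded[where x = B]) (auto simp: S_def not_less)
    with div show False by (simp add: summable_iff_shift)
  qed
  then obtain k1 where k1: "S k1 > ln ((V 0 + 1) / (y / 2)) / lam" by blast
  have "U (k + k0) < y" if "k \<ge> k1" for k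
  proof -
    have "S k1 \<le> S k" unfolding S_def using that b by (intro sum_mono2) auto
    then have "ln ((V 0 + 1) / (y / 2)) < lam * S k"
      using k1 lam by (simp add: field_simps) (smt (verit) mult_left_mono)
    then have "(V 0 + 1) / (y / 2) < exp (lam * S k)"
      using ln_ge_iff[OF V0] by (meson not_le)
    then have "exp (- lam * S k) * (V 0 + 1) < y / 2"
      using y by (simp add: exp_minus field_simps)
    moreover have "exp (- lam * S k) * V 0 \<le> exp (- lam * S k) * (V 0 + 1)"
      by (intro mult_left_mono) auto
    ultimately have "V k < y / 2" using V[of k] by linarith
    moreover have "U (k + k0) - y / 2 \<le> V k" by (simp add: V_def)
    ultimately show ?thesis by linarith
  qed
  then have "\<And>k. k \<ge> k1 + k0 \<Longrightarrow> U k < y"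
    by (metis add.commute add_le_imp_le_left le_add_diff_inverse2 le_add2 order_trans)
  then show "\<forall>\<^sub>F k in sequentially. U k < y" unfolding eventually_sequentially by blast
qed

section \<open>Smallest eigenvalue and quadratic form\<close>

text \<open>\<open>lambda_min\<close> is a \<open>Min\<close>, which is informative only for finite
  sets. By symmetry, unit eigenvectors of distinct eigenvalues are orthonormal, and Bessel's
  inequality for the \<open>n\<close> coordinate vectors then allows at most \<open>n\<close> of
  them.\<close>

lemma eigenvalues_finite:
  fixes S :: "nat \<Rightarrow> nat \<Rightarrow> real"
  assumes sym: "\<And>p q. p < n \<Longrightarrow> q < n \<Longrightarrow> S p q = S q p"
  shows "finite {l. \<exists>x. (\<exists>p<n. x p \<noteq> 0) \<and> (\<forall>p<n. (\<Sum>q<n. S p q * x q) = l * x p)}" (is "finite ?E")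
proof (rule finite_if_finite_subsets_card_bdd[THEN conjunct1])
  fix T assume T: "T \<subseteq> ?E" "finite T"
  have "\<forall>l\<in>T. \<exists>x. (\<Sum>p<n. (x p)\<^sup>2) = 1 \<and> (\<forall>p<n. (\<Sum>q<n. S p q * x q) = l * x p)"
  proof
    fix l assume "l \<in> T"
    then obtain x p where x: "p < n" "x p \<noteq> 0" "\<forall>p<n. (\<Sum>q<n. S p q * x q) = l * x p" using T by auto
    define s where "s = (\<Sum>p<n. (x p)\<^sup>2)"
    have "s > 0" unfolding s_def using x by (intro sum_pos2[of _ p]) auto
    then have "(\<Sum>p<n. (x p / sqrt s)\<^sup>2) = 1" by (simp add: power_divide s_def[symmetric] sum_divide_distrib[symmetric])
    moreover have "\<forall>p<n. (\<Sum>q<n. S p q * (x q / sqrt s)) = l * (x p / sqrt s)"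
      using x(3) by (simp add: sum_divide_distrib[symmetric])
    ultimately show "\<exists>x. (\<Sum>p<n. (x p)\<^sup>2) = 1 \<and> (\<forall>p<n. (\<Sum>q<n. S p q * x q) = l * x p)"
      by (intro exI[of _ "\<lambda>p. x p / sqrt s"]) auto
  qed
  then obtain u where u: "\<And>l. l \<in> T \<Longrightarrow> (\<Sum>p<n. (u l p)\<^sup>2) = 1"
      "\<And>l p. l \<in> T \<Longrightarrow> p < n \<Longrightarrow> (\<Sum>q<n. S p q * u l q) = l * u l p" by metis
  have orth: "(\<Sum>p<n. u l p * u l' p) = (if l = l' then 1 else 0)" if l: "l \<in> T" "l' \<in> T" for l l'
  proof (cases "l = l'")
    case False
    have "l * (\<Sum>p<n. u l p * u l' p) = (\<Sum>p<n. \<Sum>q<n. S p q * u l q * u l' p)"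
      by (simp add: u(2)[OF l(1)] sum_distrib_right[symmetric]) (simp add: sum_distrib_left mult.assoc)
    also have "\<dots> = (\<Sum>q<n. \<Sum>p<n. S q p * u l' p * u l q)"
      by (subst sum.swap) (auto intro!: sum.cong simp: sym)
    also have "\<dots> = l' * (\<Sum>p<n. u l p * u l' p)"
      by (simp add: u(2)[OF l(2)] sum_distrib_right[symmetric]) (simp add: sum_distrib_left mult_ac)
    finally show ?thesis using False by simp
  qed (use u(1) l in \<open>auto simp: power2_eq_square\<close>)
  \<comment> \<open>The square expanded below is the squared distance of the \<open>p\<close>-th
    coordinate vector from its projection onto the span of the \<open>u l\<close>; the coefficients
    of that projection are the \<open>u l p\<close>.\<close>
  have bessel: "(\<Sum>l\<in>T. (u l p)\<^sup>2) \<le> 1" if p: "p < n" for p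
  proof -
    have "0 \<le> (\<Sum>q<n. ((if q = p then 1 else 0) - (\<Sum>l\<in>T. u l p * u l q))\<^sup>2)" by (intro sum_nonneg) auto
    also have "\<dots> = (\<Sum>q<n. (if q = p then 1 else 0)\<^sup>2) - 2 * (\<Sum>q<n. (if q = p then 1 else 0) * (\<Sum>l\<in>T. u l p * u l q))
        + (\<Sum>q<n. (\<Sum>l\<in>T. u l p * u l q)\<^sup>2)"
      by (simp only: power2_diff sum.distrib sum_subtractf sum_distrib_left[of 2, symmetric] mult.assoc)
    also have "(\<Sum>q<n. (if q = p then 1 else 0)\<^sup>2) = (1::real)"
      using p by (simp add: if_distrib[where f = "\<lambda>z. z\<^sup>2"] cong: if_cong)
    also have "(\<Sum>q<n. (if q = p then 1 else 0) * (\<Sum>l\<in>T. u l p * u l q)) = (\<Sum>l\<in>T. (u l p)\<^sup>2)"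
      using p by (simp add: power2_eq_square if_distrib[where f = "\<lambda>z. z * _"] cong: if_cong)
    also have "(\<Sum>q<n. (\<Sum>l\<in>T. u l p * u l q)\<^sup>2) = (\<Sum>q<n. \<Sum>l\<in>T. \<Sum>l'\<in>T. u l p * u l' p * (u l q * u l' q))"
      by (simp add: power2_eq_square sum_product mult_ac)
    also have "\<dots> = (\<Sum>l\<in>T. \<Sum>l'\<in>T. u l p * u l' p * (\<Sum>q<n. u l q * u l' q))"
      by (subst sum.swap, rule sum.cong[OF refl], subst sum.swap) (simp add: sum_distrib_left)
    also have "\<dots> = (\<Sum>l\<in>T. (u l p)\<^sup>2)"
      using T by (simp add: orth power2_eq_square if_distrib cong: if_cong)
    finally show ?thesis by simp
  qed
  have "real (card T) = (\<Sum>l\<in>T. \<Sum>p<n. (u l p)\<^sup>2)" using u(1) by simp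
  also have "\<dots> = (\<Sum>p<n. \<Sum>l\<in>T. (u l p)\<^sup>2)" by (rule sum.swap)
  also have "\<dots> \<le> (\<Sum>p<n. 1)" using bessel by (intro sum_mono) auto
  finally show "card T \<le> n" by simp
qed

text \<open>Vectors are functions on all of \<open>nat\<close>, with the product topology. Fixing
  the coordinates from \<open>n\<close> on at 0 makes the sphere a closed subset of a product of
  compact intervals and points, compact by Tychonoff.\<close>

lemma compact_unit_sphere_coordinates:
  "compact {x :: nat \<Rightarrow> real. (\<forall>k\<ge>n. x k = 0) \<and> (\<Sum>p<n. (x p)\<^sup>2) = 1}"
proof -
  define A :: "nat \<Rightarrow> real set" where "A k = (if k < n then {-1..1} else {0})" for k
  have "compactin (product_topology (\<lambda>k. euclidean) (UNIV :: nat set)) (PiE UNIV A)"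
    by (subst compactin_PiE) (auto simp: A_def)
  then have cpt: "compact (PiE UNIV A)" by (simp add: euclidean_product_topology)
  have cl: "closed {x :: nat \<Rightarrow> real. (\<Sum>p<n. (x p)\<^sup>2) = 1}"
    by (intro closed_Collect_eq continuous_intros continuous_on_product_coordinates)
  have "x k \<in> A k" if x: "(\<forall>k\<ge>n. x k = 0) \<and> (\<Sum>p<n. (x p)\<^sup>2) = 1" for x :: "nat \<Rightarrow> real" and k
  proof (cases "k < n")
    case True
    then have "(x k)\<^sup>2 \<le> (\<Sum>p<n. (x p)\<^sup>2)" by (intro member_le_sum) auto
    then have "\<bar>x k\<bar> \<le> 1" using x by (simp add: abs_square_le_1)
    then show ?thesis using True by (auto simp: A_def)
  qed (use x in \<open>auto simp: A_def\<close>)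
  moreover have "x k = 0" if "x \<in> PiE UNIV A" "k \<ge> n" for x k
    using that PiE_mem[OF that(1), of k] by (auto simp: A_def)
  ultimately have "{x :: nat \<Rightarrow> real. (\<forall>k\<ge>n. x k = 0) \<and> (\<Sum>p<n. (x p)\<^sup>2) = 1}
    = PiE UNIV A \<inter> {x. (\<Sum>p<n. (x p)\<^sup>2) = 1}" by auto
  then show ?thesis using compact_Int_closed[OF cpt cl] by simp
qed

text \<open>A minimiser \<open>u\<close> of the form on the unit sphere is an eigenvector, so the
  minimum \<open>l\<close> is one of the eigenvalues of which \<open>lambda_min\<close> is the
  least. No diagonalisation is involved.\<close>

lemma lambda_min_le_quadratic_form:
  fixes S :: "nat \<Rightarrow> nat \<Rightarrow> real"
  assumes n: "n > 0" and sym: "\<And>p q. p < n \<Longrightarrow> q < n \<Longrightarrow> S p q = S q p"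
  shows "lambda_min n S * (\<Sum>p<n. (x p)\<^sup>2) \<le> (\<Sum>p<n. \<Sum>q<n. S p q * x p * x q)"
proof -
  define Q where "Q x = (\<Sum>p<n. \<Sum>q<n. S p q * x p * x q)" for x :: "nat \<Rightarrow> real"
  define B where "B x y = (\<Sum>p<n. y p * (\<Sum>q<n. S p q * x q))" for x y :: "nat \<Rightarrow> real"
  define K where "K = {x :: nat \<Rightarrow> real. (\<forall>k\<ge>n. x k = 0) \<and> (\<Sum>p<n. (x p)\<^sup>2) = 1}"
  have "(\<lambda>k. if k = 0 then 1 else 0) \<in> K"
    using n by (auto simp: K_def if_distrib[where f = "\<lambda>z. z\<^sup>2"] cong: if_cong)
  then have "K \<noteq> {}" by blast
  moreover have "continuous_on K Q" unfolding Q_def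
    by (intro continuous_intros continuous_on_subset[OF continuous_on_product_coordinates subset_UNIV])
  moreover have "compact K" unfolding K_def by (rule compact_unit_sphere_coordinates)
  ultimately have "\<exists>u\<in>K. \<forall>y\<in>K. Q u \<le> Q y" by (intro continuous_attains_inf)
  then obtain u where u: "u \<in> K" and umin: "\<And>y. y \<in> K \<Longrightarrow> Q u \<le> Q y" by blast
  define l where "l = Q u"
  have low: "l * (\<Sum>p<n. (y p)\<^sup>2) \<le> Q y" for y
  proof (cases "(\<Sum>p<n. (y p)\<^sup>2) = 0")
    case True
    then have "\<forall>p<n. y p = 0" by (simp add: sum_nonneg_eq_0_iff)
    then show ?thesis using True by (simp add: Q_def)
  next
    case False
    define s where "s = (\<Sum>p<n. (y p)\<^sup>2)"
    have s: "s > 0" using False by (simp add: s_def less_le sum_nonneg)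
    define z where "z k = (if k < n then y k / sqrt s else 0)" for k
    have "(\<Sum>p<n. (z p)\<^sup>2) = 1" using s
      by (simp add: z_def power_divide sum_divide_distrib[symmetric]) (simp add: s_def)
    then have "z \<in> K" by (auto simp: K_def z_def)
    then have "l \<le> Q z" using umin l_def by auto
    also have "Q z = Q y / s" using s by (simp add: Q_def z_def sum_divide_distrib)
    finally show ?thesis using s by (simp add: s_def[symmetric] field_simps)
  qed
  \<comment> \<open>The residual of the eigenvalue equation at \<open>u\<close>. Moving
    \<open>u\<close> by \<open>t * r\<close> changes the form minus \<open>l\<close> times the
    squared norm by \<open>2 * t * R\<close> to first order; as this difference attains its minimum
    0 at \<open>u\<close>, \<open>R\<close> has to vanish.\<close>
  define r where "r p = (\<Sum>q<n. S p q * u q) - l * u p" for p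
  define R where "R = (\<Sum>p<n. (r p)\<^sup>2)"
  have usq: "(\<Sum>p<n. (u p)\<^sup>2) = 1" using u by (simp add: K_def)
  have Bsym: "B x y = B y x" for x y
    unfolding B_def sum_distrib_left by (subst sum.swap) (auto intro!: sum.cong simp: sym)
  have QB: "Q x = B x x" for x by (simp add: Q_def B_def sum_distrib_left mult_ac)
  have expand: "0 \<le> 2 * t * R + t\<^sup>2 * (Q r - l * R)" for t
  proof -
    have "Q (\<lambda>p. u p + t * r p) = Q u + 2 * t * B u r + t\<^sup>2 * Q r"
    proof -
      have "B (\<lambda>p. u p + t * r p) (\<lambda>p. u p + t * r p) = B u u + t * B u r + t * B r u + t\<^sup>2 * B r r"
        by (simp add: B_def algebra_simps sum.distrib sum_distrib_left power2_eq_square)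
      then show ?thesis using Bsym[of r u] by (simp add: QB)
    qed
    moreover have "(\<Sum>p<n. (u p + t * r p)\<^sup>2) = 1 + 2 * t * (\<Sum>p<n. u p * r p) + t\<^sup>2 * R"
      by (simp add: power2_sum usq R_def sum.distrib sum_distrib_left power_mult_distrib mult_ac)
    moreover have "B u r = R + l * (\<Sum>p<n. u p * r p)"
    proof -
      have "(\<Sum>q<n. S p q * u q) = r p + l * u p" for p by (simp add: r_def)
      then show ?thesis
        by (simp add: B_def R_def power2_eq_square sum_distrib_left sum.distrib distrib_left mult_ac)
    qed
    ultimately show ?thesis
      using low[of "\<lambda>p. u p + t * r p"] l_def by (simp add: algebra_simps)
  qed
  have "R = 0"
  proof (rule ccontr)
    assume "R \<noteq> 0"
    then have R: "R > 0" by (simp add: R_def less_le sum_nonneg)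
    \<comment> \<open>A positive upper bound of the quadratic coefficient. The value
      \<open>t = - R / c\<close> minimises \<open>2 * t * R + t\<^sup>2 * c\<close> and makes it
      \<open>- (R\<^sup>2 / c)\<close>.\<close>
    define c where "c = \<bar>Q r - l * R\<bar> + 1"
    have c: "c > 0" "Q r - l * R < c" by (auto simp: c_def)
    have "0 \<le> 2 * (- R / c) * R + (- R / c)\<^sup>2 * (Q r - l * R)" by (rule expand)
    also have "\<dots> \<le> 2 * (- R / c) * R + (- R / c)\<^sup>2 * c"
      using c by (intro add_left_mono mult_left_mono) auto
    also have "\<dots> = - (R\<^sup>2 / c)" using c by (simp add: power2_eq_square field_simps)
    finally show False using R c by (smt (verit) divide_pos_pos zero_less_power)
  qed
  then have "\<forall>p<n. r p = 0" by (simp add: R_def sum_nonneg_eq_0_iff)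
  then have ev: "\<forall>p<n. (\<Sum>q<n. S p q * u q) = l * u p" by (simp add: r_def)
  have "\<exists>p<n. u p \<noteq> 0" 
  proof (rule ccontr)
    assume "\<not> ?thesis"
    then have "(\<Sum>p<n. (u p)\<^sup>2) = 0" by simp
    with usq show False by simp
  qed
  then have "lambda_min n S \<le> l"
    unfolding lambda_min_def using ev eigenvalues_finite[OF sym, of n] by (intro Min_le) auto
  then have "lambda_min n S * (\<Sum>p<n. (x p)\<^sup>2) \<le> l * (\<Sum>p<n. (x p)\<^sup>2)"
    by (intro mult_right_mono sum_nonneg) auto
  then show ?thesis using low[of x] by (simp add: Q_def)
qed

section \<open>Pointwise estimates for one step\<close>

text \<open>Young's inequality with weight \<open>s\<close> for each pair of entries; every square
  then occurs \<open>n\<close> times. The free weight lets later estimates shift almost all of a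
  cross term onto one of the two vectors.\<close>

lemma bilinear_form_bound:
  fixes x y :: "nat \<Rightarrow> real" and B :: "nat \<Rightarrow> nat \<Rightarrow> real"
  assumes B: "\<And>p q. p < n \<Longrightarrow> q < n \<Longrightarrow> \<bar>B p q\<bar> \<le> K" and K: "K \<ge> 0" and s: "s > 0"
  shows "2 * \<bar>\<Sum>p<n. \<Sum>q<n. B p q * x p * y q\<bar>
    \<le> n * K * (s * (\<Sum>p<n. (x p)\<^sup>2) + (\<Sum>p<n. (y p)\<^sup>2) / s)"
proof -
  have t: "2 * \<bar>B p q * x p * y q\<bar> \<le> K * (s * (x p)\<^sup>2 + (y q)\<^sup>2 / s)" if "p < n" "q < n" for p q
  proof -
    have "0 \<le> (s * \<bar>x p\<bar> - \<bar>y q\<bar>)\<^sup>2 / s" using s by simp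
    also have "\<dots> = s * (x p)\<^sup>2 + (y q)\<^sup>2 / s - 2 * (\<bar>x p\<bar> * \<bar>y q\<bar>)"
      using s by (simp add: power2_eq_square field_simps)
    finally have *: "2 * (\<bar>x p\<bar> * \<bar>y q\<bar>) \<le> s * (x p)\<^sup>2 + (y q)\<^sup>2 / s" by simp
    have "2 * \<bar>B p q * x p * y q\<bar> = \<bar>B p q\<bar> * (2 * (\<bar>x p\<bar> * \<bar>y q\<bar>))" by (simp add: abs_mult)
    also have "\<dots> \<le> K * (s * (x p)\<^sup>2 + (y q)\<^sup>2 / s)"
      using B[OF that] * K by (intro mult_mono) auto
    finally show ?thesis .
  qed
  have "2 * \<bar>\<Sum>p<n. \<Sum>q<n. B p q * x p * y q\<bar> \<le> (\<Sum>p<n. \<Sum>q<n. 2 * \<bar>B p q * x p * y q\<bar>)"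
    by (simp add: sum_distrib_left[symmetric] order_trans[OF sum_abs sum_mono[OF sum_abs]])
  also have "\<dots> \<le> (\<Sum>p<n. \<Sum>q<n. K * (s * (x p)\<^sup>2 + (y q)\<^sup>2 / s))"
    using t by (intro sum_mono) auto
  also have "\<dots> = n * K * (s * (\<Sum>p<n. (x p)\<^sup>2) + (\<Sum>p<n. (y p)\<^sup>2) / s)"
    by (simp add: sum_distrib_left[symmetric] sum.distrib sum_divide_distrib[symmetric] algebra_simps)
  finally show ?thesis .
qed

lemma matrix_vector_square_bound:
  fixes x :: "nat \<Rightarrow> real" and B :: "nat \<Rightarrow> nat \<Rightarrow> real"
  assumes B: "\<And>p q. p < n \<Longrightarrow> q < n \<Longrightarrow> \<bar>B p q\<bar> \<le> K" and K: "K \<ge> 0"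
  shows "(\<Sum>p<n. (\<Sum>q<n. B p q * x q)\<^sup>2) \<le> (n * K)\<^sup>2 * (\<Sum>p<n. (x p)\<^sup>2)"
proof -
  have "(\<Sum>q<n. B p q * x q)\<^sup>2 \<le> n * K\<^sup>2 * (\<Sum>p<n. (x p)\<^sup>2)" if "p < n" for p
  proof -
    have "(\<Sum>q<n. B p q * x q)\<^sup>2 \<le> (\<Sum>q<n. (B p q * x q)\<^sup>2) * card {..<n}"
      by (rule sum_squared_le_sum_of_squares)
    also have "(\<Sum>q<n. (B p q * x q)\<^sup>2) \<le> (\<Sum>q<n. K\<^sup>2 * (x q)\<^sup>2)"
      unfolding power_mult_distrib using B[OF that] K
      by (intro sum_mono mult_right_mono) (auto simp: abs_le_square_iff[symmetric])
    finally show ?thesis by (simp add: sum_distrib_left[symmetric] mult_right_mono algebra_simps)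
  qed
  then have "(\<Sum>p<n. (\<Sum>q<n. B p q * x q)\<^sup>2) \<le> (\<Sum>p<n. n * K\<^sup>2 * (\<Sum>p<n. (x p)\<^sup>2))"
    by (intro sum_mono) auto
  then show ?thesis by (simp add: power2_eq_square algebra_simps)
qed

lemma sum_power2_add_le:
  fixes x y :: "nat \<Rightarrow> real"
  shows "(\<Sum>p<n. (x p + y p)\<^sup>2) \<le> 2 * (\<Sum>p<n. (x p)\<^sup>2) + 2 * (\<Sum>p<n. (y p)\<^sup>2)"
proof -
  have "(\<Sum>p<n. (x p + y p)\<^sup>2) \<le> (\<Sum>p<n. 2 * (x p)\<^sup>2 + 2 * (y p)\<^sup>2)"
    by (intro sum_mono) (smt (verit) power2_sum power2_diff zero_le_power2)
  then show ?thesis by (simp add: sum.distrib sum_distrib_left)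
qed

text \<open>The factor 12 is 3 * 4: 3 for the square of a sum of three terms, 4 for the square of
  the bound \<open>2 * b\<close> on the step sizes.\<close>

lemma increment_square_bound:
  fixes e w u a :: "nat \<Rightarrow> real" and G :: "nat \<Rightarrow> nat \<Rightarrow> real"
  assumes G: "\<And>p q. p < n \<Longrightarrow> q < n \<Longrightarrow> \<bar>G p q\<bar> \<le> K" and K: "K \<ge> 0"
    and w: "\<And>p. p < n \<Longrightarrow> \<bar>w p\<bar> \<le> \<phi>" and a: "\<And>p. p < n \<Longrightarrow> \<bar>a p\<bar> \<le> 2 * b"
    and b: "b \<ge> 0"
  shows "(\<Sum>p<n. (a p * (w p + u p - (\<Sum>q<n. G p q * e q)))\<^sup>2)
    \<le> 12 * b\<^sup>2 * (n * \<phi>\<^sup>2 + (\<Sum>p<n. (u p)\<^sup>2) + (n * K)\<^sup>2 * (\<Sum>p<n. (e p)\<^sup>2))"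
proof -
  have "(a p * (w p + u p - (\<Sum>q<n. G p q * e q)))\<^sup>2
      \<le> 12 * b\<^sup>2 * (\<phi>\<^sup>2 + (u p)\<^sup>2 + (\<Sum>q<n. G p q * e q)\<^sup>2)" if p: "p < n" for p
  proof -
    define z where "z = (\<Sum>q<n. G p q * e q)"
    have "(w p + u p - z)\<^sup>2 = 3 * ((w p)\<^sup>2 + (u p)\<^sup>2 + z\<^sup>2) - ((w p - u p)\<^sup>2 + (w p + z)\<^sup>2 + (u p + z)\<^sup>2)"
      by (simp add: power2_eq_square algebra_simps)
    then have "(w p + u p - z)\<^sup>2 \<le> 3 * ((w p)\<^sup>2 + (u p)\<^sup>2 + z\<^sup>2)" by (smt (verit) zero_le_power2)
    moreover have "(w p)\<^sup>2 \<le> \<phi>\<^sup>2" using w[OF p] by (simp add: abs_le_square_iff[symmetric])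
    ultimately have 1: "(w p + u p - z)\<^sup>2 \<le> 3 * (\<phi>\<^sup>2 + (u p)\<^sup>2 + z\<^sup>2)"
      by (elim order_trans) simp
    have 2: "(a p)\<^sup>2 \<le> (2 * b)\<^sup>2" using a[OF p] b by (subst abs_le_square_iff[symmetric]) auto
    have "(a p * (w p + u p - z))\<^sup>2 \<le> (2 * b)\<^sup>2 * (3 * (\<phi>\<^sup>2 + (u p)\<^sup>2 + z\<^sup>2))"
      unfolding power_mult_distrib[of "a p"] by (intro mult_mono 1 2) auto
    then show ?thesis by (simp add: z_def power2_eq_square algebra_simps)
  qed
  then have "(\<Sum>p<n. (a p * (w p + u p - (\<Sum>q<n. G p q * e q)))\<^sup>2)
      \<le> (\<Sum>p<n. 12 * b\<^sup>2 * (\<phi>\<^sup>2 + (u p)\<^sup>2 + (\<Sum>q<n. G p q * e q)\<^sup>2))" by (intro sum_mono) auto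
  also have "\<dots> = 12 * b\<^sup>2 * (n * \<phi>\<^sup>2 + (\<Sum>p<n. (u p)\<^sup>2) + (\<Sum>p<n. (\<Sum>q<n. G p q * e q)\<^sup>2))"
    by (simp add: sum_distrib_left[symmetric] sum.distrib)
  also have "\<dots> \<le> 12 * b\<^sup>2 * (n * \<phi>\<^sup>2 + (\<Sum>p<n. (u p)\<^sup>2) + (n * K)\<^sup>2 * (\<Sum>p<n. (e p)\<^sup>2))"
    using matrix_vector_square_bound[of n G K e] G K by (intro mult_left_mono add_left_mono) auto
  finally show ?thesis .
qed

text \<open>Here \<open>e\<close> is the current error and \<open>c\<close> the error frozen at the
  start of the block. The form is evaluated at \<open>c\<close>, where conditioning can be applied
  later. Cross terms between \<open>c\<close> and \<open>e - c\<close> are split so that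
  \<open>c\<close> receives the small factor \<open>\<eta>\<close> and \<open>e - c\<close> the
  large factor \<open>\<kappa>\<^sup>2 / \<eta>\<close>, which is harmless because the squared drift
  is of order \<open>b\<^sup>2\<close> in the mean. The term in \<open>e p * u p\<close> is kept
  exact, as its mean vanishes.\<close>

lemma one_step_pointwise:
  fixes e c w u a :: "nat \<Rightarrow> real" and G :: "nat \<Rightarrow> nat \<Rightarrow> real"
  assumes G: "\<And>p q. p < n \<Longrightarrow> q < n \<Longrightarrow> \<bar>G p q\<bar> \<le> K" and K: "K \<ge> 0"
    and w: "\<And>p. p < n \<Longrightarrow> \<bar>w p\<bar> \<le> \<phi>" and a: "\<And>p. p < n \<Longrightarrow> \<bar>a p - b\<bar> \<le> \<epsilon> * b"
    and b: "0 \<le> b" and eps: "0 \<le> \<epsilon>" "\<epsilon> \<le> 1" and eta: "\<eta> > 0"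
    and kap: "\<kappa> = n * K + 1"
  shows "(\<Sum>p<n. (e p + a p * (w p + u p - (\<Sum>q<n. G p q * e q)))\<^sup>2)
    \<le> (\<Sum>p<n. (e p)\<^sup>2) + 2 * (\<Sum>p<n. a p * (e p * u p)) - 2 * b * (\<Sum>p<n. \<Sum>q<n. G p q * c p * c q)
      + b * (6 * \<eta> + 4 * \<epsilon> * \<kappa> + 24 * b * \<kappa>\<^sup>2) * (\<Sum>p<n. (c p)\<^sup>2)
      + b * (4 * \<epsilon> * \<kappa> + 2 * \<kappa> + 2 * \<kappa>\<^sup>2 / \<eta> + 4 * \<eta> + 24 * b * \<kappa>\<^sup>2) * (\<Sum>p<n. (e p - c p)\<^sup>2)
      + (2 * b * n * \<phi>\<^sup>2 / \<eta> + 12 * b\<^sup>2 * n * \<phi>\<^sup>2) + 12 * b\<^sup>2 * (\<Sum>p<n. (u p)\<^sup>2)"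
proof -
  define g where "g p = (\<Sum>q<n. G p q * e q)" for p
  define d where "d p = e p - c p" for p
  define nn where "nn x = (\<Sum>p<n. (x p)\<^sup>2)" for x :: "nat \<Rightarrow> real"
  define B where "B x y = (\<Sum>p<n. \<Sum>q<n. G p q * x p * y q)" for x y
  have nn0: "nn x \<ge> 0" for x unfolding nn_def by (intro sum_nonneg) auto
  \<comment> \<open>The summand 1 in \<open>\<kappa>\<close> permits division by it even if
    \<open>n * K\<close> is 0.\<close>
  have kap0: "\<kappa> > 0" "n * K \<le> \<kappa>" using K kap by (auto intro: add_nonneg_pos)
  have ne: "nn e \<le> 2 * nn c + 2 * nn d"
    using sum_power2_add_le[of c d n] by (simp add: nn_def d_def)
  have Bb: "2 * \<bar>B x y\<bar> \<le> \<kappa> * (s * nn x + nn y / s)" if "s > 0" for x y s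
  proof -
    have "2 * \<bar>B x y\<bar> \<le> n * K * (s * nn x + nn y / s)"
      unfolding B_def nn_def by (rule bilinear_form_bound[OF G K that])
    also have "\<dots> \<le> \<kappa> * (s * nn x + nn y / s)"
      using kap0 nn0 that by (intro mult_right_mono) (auto intro!: add_nonneg_nonneg divide_nonneg_pos mult_nonneg_nonneg)
    finally show ?thesis .
  qed
  have a2: "\<bar>a p\<bar> \<le> 2 * b" if "p < n" for p
  proof -
    have "\<epsilon> * b \<le> 1 * b" using eps b by (intro mult_right_mono) auto
    then show ?thesis using a[OF that] b by linarith
  qed
  have split: "B e e = B c c + B d c + B c d + B d d"
    unfolding B_def d_def by (simp add: algebra_simps sum.distrib sum_subtractf)
  have G1: "- 2 * b * B e e \<le> - 2 * b * B c c + b * (2 * \<eta> * nn c + (2 * \<kappa>\<^sup>2 / \<eta> + 2 * \<kappa>) * nn d)"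
  proof -
    define z where "z = \<kappa>\<^sup>2 / \<eta>"
    \<comment> \<open>This weight, and its inverse when the arguments are exchanged, turns the
      factors in \<open>Bb\<close> into \<open>\<eta>\<close> for \<open>c\<close> and
      \<open>\<kappa>\<^sup>2 / \<eta>\<close> for \<open>d\<close>.\<close>
    have s: "\<eta> / \<kappa> > 0" using eta kap0 by simp
    have "2 * \<bar>B c d\<bar> \<le> \<eta> * nn c + z * nn d"
      unfolding z_def using Bb[OF s, of c d] eta kap0 by (simp add: algebra_simps power2_eq_square)
    moreover have "2 * \<bar>B d c\<bar> \<le> \<eta> * nn c + z * nn d"
      unfolding z_def using Bb[of "\<kappa> / \<eta>" d c] eta kap0 by (simp add: algebra_simps power2_eq_square)
    moreover have "2 * \<bar>B d d\<bar> \<le> 2 * \<kappa> * nn d" using Bb[of 1 d d] by simp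
    ultimately have "- 2 * B e e \<le> - 2 * B c c + (2 * \<eta> * nn c + (2 * z + 2 * \<kappa>) * nn d)"
      unfolding split by (simp add: algebra_simps)
    from mult_left_mono[OF this b] show ?thesis by (simp add: z_def algebra_simps)
  qed
  \<comment> \<open>The coordinates have different step sizes. Replacing them by the common
    \<open>b\<close> costs a bilinear form with entries of size at most
    \<open>\<epsilon> * b * K\<close>.\<close>
  have G2: "- 2 * (\<Sum>p<n. a p * e p * g p) \<le> - 2 * b * B e e + 2 * \<epsilon> * b * \<kappa> * nn e"
  proof -
    have "2 * \<bar>\<Sum>p<n. \<Sum>q<n. ((a p - b) * G p q) * e p * e q\<bar> \<le> n * (\<epsilon> * b * K) * (1 * nn e + nn e / 1)"
      unfolding nn_def
    proof (rule bilinear_form_bound)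
      fix p q assume "p < n" "q < n"
      then show "\<bar>(a p - b) * G p q\<bar> \<le> \<epsilon> * b * K"
        unfolding abs_mult using a G K eps b by (intro mult_mono) auto
    qed (use eps b K in auto)
    also have "\<dots> = 2 * \<epsilon> * b * nn e * (n * K)" by simp
    also have "\<dots> \<le> 2 * \<epsilon> * b * nn e * \<kappa>"
      using kap0 eps b nn0 by (intro mult_left_mono) auto
    finally have "2 * \<bar>\<Sum>p<n. \<Sum>q<n. ((a p - b) * G p q) * e p * e q\<bar> \<le> 2 * \<epsilon> * b * \<kappa> * nn e"
      by (simp add: mult_ac)
    moreover have "(\<Sum>p<n. \<Sum>q<n. ((a p - b) * G p q) * e p * e q) = (\<Sum>p<n. a p * e p * g p) - b * B e e"
      by (simp add: B_def g_def algebra_simps sum_subtractf sum_distrib_left)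
    ultimately show ?thesis by linarith
  qed
  have W: "2 * (\<Sum>p<n. a p * e p * w p) \<le> 2 * b * \<eta> * nn e + 2 * b * n * \<phi>\<^sup>2 / \<eta>"
  proof -
    have "2 * (a p * e p * w p) \<le> 2 * b * (\<eta> * (e p)\<^sup>2 + \<phi>\<^sup>2 / \<eta>)" if p: "p < n" for p
    proof -
      have "0 \<le> (\<eta> * \<bar>e p\<bar> - \<bar>w p\<bar>)\<^sup>2 / \<eta>" using eta by simp
      also have "\<dots> = \<eta> * (e p)\<^sup>2 + (w p)\<^sup>2 / \<eta> - 2 * (\<bar>e p\<bar> * \<bar>w p\<bar>)"
        using eta by (simp add: power2_eq_square field_simps)
      finally have "2 * (\<bar>e p\<bar> * \<bar>w p\<bar>) \<le> \<eta> * (e p)\<^sup>2 + (w p)\<^sup>2 / \<eta>" by simp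
      also have "(w p)\<^sup>2 / \<eta> \<le> \<phi>\<^sup>2 / \<eta>"
        using w[OF p] eta by (intro divide_right_mono) (auto simp: abs_le_square_iff[symmetric])
      finally have *: "2 * (\<bar>e p\<bar> * \<bar>w p\<bar>) \<le> \<eta> * (e p)\<^sup>2 + \<phi>\<^sup>2 / \<eta>" by simp
      have "2 * (a p * e p * w p) \<le> \<bar>a p\<bar> * (2 * (\<bar>e p\<bar> * \<bar>w p\<bar>))"
        by (simp add: abs_mult[symmetric] mult.assoc)
      also have "\<dots> \<le> 2 * b * (\<eta> * (e p)\<^sup>2 + \<phi>\<^sup>2 / \<eta>)"
        using a2[OF p] * b by (intro mult_mono) auto
      finally show ?thesis .
    qed
    then have "(\<Sum>p<n. 2 * (a p * e p * w p)) \<le> (\<Sum>p<n. 2 * b * (\<eta> * (e p)\<^sup>2 + \<phi>\<^sup>2 / \<eta>))"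
      by (intro sum_mono) auto
    moreover have "(\<Sum>p<n. 2 * (a p * e p * w p)) = 2 * (\<Sum>p<n. a p * e p * w p)"
      by (simp add: sum_distrib_left)
    moreover have "(\<Sum>p<n. 2 * b * (\<eta> * (e p)\<^sup>2 + \<phi>\<^sup>2 / \<eta>)) = 2 * b * \<eta> * nn e + 2 * b * n * \<phi>\<^sup>2 / \<eta>"
      by (simp add: sum_distrib_left[symmetric] sum.distrib nn_def algebra_simps)
    ultimately show ?thesis by simp
  qed
  have Sq: "(\<Sum>p<n. (a p * (w p + u p - g p))\<^sup>2) \<le> 12 * b\<^sup>2 * n * \<phi>\<^sup>2 + 12 * b\<^sup>2 * nn u + 12 * b\<^sup>2 * \<kappa>\<^sup>2 * nn e"
  proof -
    have "(\<Sum>p<n. (a p * (w p + u p - g p))\<^sup>2) \<le> 12 * b\<^sup>2 * (n * \<phi>\<^sup>2 + nn u + (n * K)\<^sup>2 * nn e)"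
      unfolding g_def nn_def by (rule increment_square_bound[OF G K w a2 b])
    also have "\<dots> \<le> 12 * b\<^sup>2 * (n * \<phi>\<^sup>2 + nn u + \<kappa>\<^sup>2 * nn e)"
      using kap0 nn0 K by (intro mult_left_mono add_left_mono mult_right_mono power_mono) auto
    finally show ?thesis by (simp add: algebra_simps)
  qed
  have exp: "(\<Sum>p<n. (e p + a p * (w p + u p - g p))\<^sup>2)
     = nn e + 2 * (\<Sum>p<n. a p * (e p * u p)) + 2 * (\<Sum>p<n. a p * e p * w p) - 2 * (\<Sum>p<n. a p * e p * g p)
       + (\<Sum>p<n. (a p * (w p + u p - g p))\<^sup>2)"
  proof -
    have "(e p + a p * (w p + u p - g p))\<^sup>2 = (e p)\<^sup>2 + 2 * (a p * (e p * u p)) + 2 * (a p * e p * w p)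
        - 2 * (a p * e p * g p) + (a p * (w p + u p - g p))\<^sup>2" for p
      by (simp add: power2_eq_square algebra_simps)
    then show ?thesis by (simp add: nn_def sum.distrib sum_subtractf sum_distrib_left)
  qed
  have co: "0 \<le> 2 * \<epsilon> * b * \<kappa> + 2 * b * \<eta> + 12 * b\<^sup>2 * \<kappa>\<^sup>2"
    using eps b kap0 eta by (auto intro!: add_nonneg_nonneg mult_nonneg_nonneg)
  have "(\<Sum>p<n. (e p + a p * (w p + u p - g p))\<^sup>2)
    \<le> nn e + 2 * (\<Sum>p<n. a p * (e p * u p)) - 2 * b * B c c
      + b * (2 * \<eta> * nn c + (2 * \<kappa>\<^sup>2 / \<eta> + 2 * \<kappa>) * nn d)
      + (2 * \<epsilon> * b * \<kappa> + 2 * b * \<eta> + 12 * b\<^sup>2 * \<kappa>\<^sup>2) * nn e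
      + 2 * b * n * \<phi>\<^sup>2 / \<eta> + 12 * b\<^sup>2 * n * \<phi>\<^sup>2 + 12 * b\<^sup>2 * nn u"
    using exp G1 G2 W Sq by (simp add: algebra_simps)
  \<comment> \<open>Only the leading \<open>nn e\<close> is kept; its other multiples are traded for
    \<open>c\<close> and \<open>d\<close>. Hence \<open>6 * \<eta>\<close> is
    \<open>2 * \<eta>\<close> from the form plus twice the \<open>2 * \<eta>\<close> of the event
    term.\<close>
  also have "\<dots> \<le> nn e + 2 * (\<Sum>p<n. a p * (e p * u p)) - 2 * b * B c c
      + b * (2 * \<eta> * nn c + (2 * \<kappa>\<^sup>2 / \<eta> + 2 * \<kappa>) * nn d)
      + (2 * \<epsilon> * b * \<kappa> + 2 * b * \<eta> + 12 * b\<^sup>2 * \<kappa>\<^sup>2) * (2 * nn c + 2 * nn d)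
      + 2 * b * n * \<phi>\<^sup>2 / \<eta> + 12 * b\<^sup>2 * n * \<phi>\<^sup>2 + 12 * b\<^sup>2 * nn u"
    using mult_left_mono[OF ne co] by simp
  also have "\<dots> = nn e + 2 * (\<Sum>p<n. a p * (e p * u p)) - 2 * b * B c c
      + b * (6 * \<eta> + 4 * \<epsilon> * \<kappa> + 24 * b * \<kappa>\<^sup>2) * nn c
      + b * (4 * \<epsilon> * \<kappa> + 2 * \<kappa> + 2 * \<kappa>\<^sup>2 / \<eta> + 4 * \<eta> + 24 * b * \<kappa>\<^sup>2) * nn d
      + (2 * b * n * \<phi>\<^sup>2 / \<eta> + 12 * b\<^sup>2 * n * \<phi>\<^sup>2) + 12 * b\<^sup>2 * nn u"
    by (simp add: algebra_simps power2_eq_square)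
  finally show ?thesis unfolding nn_def B_def g_def d_def .
qed

section \<open>Perturbed linear recursions in mean square\<close>

text \<open>Measurability of \<open>X\<close> is a separate conjunct, since integrability of the
  square yields only measurability of the square.\<close>

definition square_integrable :: "'a measure \<Rightarrow> ('a \<Rightarrow> real) \<Rightarrow> bool" where
  "square_integrable M X \<longleftrightarrow> X \<in> borel_measurable M \<and> integrable M (\<lambda>x. (X x)\<^sup>2)"

lemma square_integrableD:
  "square_integrable M X \<Longrightarrow> X \<in> borel_measurable M"
  "square_integrable M X \<Longrightarrow> integrable M (\<lambda>x. (X x)\<^sup>2)"
  by (auto simp: square_integrable_def)

lemma square_integrable_mult:
  assumes "square_integrable M X" "square_integrable M Y"
  shows "integrable M (\<lambda>x. X x * Y x)"
proof (rule Bochner_Integration.integrable_bound)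
  show "integrable M (\<lambda>x. (X x)\<^sup>2 + (Y x)\<^sup>2)" using assms by (auto simp: square_integrable_def)
  show "(\<lambda>x. X x * Y x) \<in> borel_measurable M" using assms by (auto simp: square_integrable_def)
  have "\<bar>X x * Y x\<bar> \<le> (X x)\<^sup>2 + (Y x)\<^sup>2" for x
  proof -
    have "2 * (\<bar>X x\<bar> * \<bar>Y x\<bar>) \<le> (X x)\<^sup>2 + (Y x)\<^sup>2"
      using zero_le_power2[of "\<bar>X x\<bar> - \<bar>Y x\<bar>"] by (simp add: power2_diff)
    moreover have "0 \<le> \<bar>X x\<bar> * \<bar>Y x\<bar>" by simp
    ultimately show ?thesis unfolding abs_mult by linarith
  qed
  then show "AE x in M. norm (X x * Y x) \<le> norm ((X x)\<^sup>2 + (Y x)\<^sup>2)" by auto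
qed

lemma square_integrable_add:
  assumes "square_integrable M X" "square_integrable M Y"
  shows "square_integrable M (\<lambda>x. X x + Y x)"
  using assms square_integrable_mult[OF assms]
  by (auto simp: square_integrable_def power2_sum mult.assoc)

lemma square_integrable_cmult:
  "square_integrable M X \<Longrightarrow> square_integrable M (\<lambda>x. c * X x)"
  by (auto simp: square_integrable_def power_mult_distrib)

lemma square_integrable_diff:
  assumes "square_integrable M X" "square_integrable M Y"
  shows "square_integrable M (\<lambda>x. X x - Y x)"
  using square_integrable_add[OF assms(1) square_integrable_cmult[OF assms(2), of "-1"]] by simp

lemma square_integrable_sum:
  "(\<And>i. i \<in> I \<Longrightarrow> square_integrable M (X i)) \<Longrightarrow> square_integrable M (\<lambda>x. \<Sum>i\<in>I. X i x)"
  by (induction I rule: infinite_finite_induct)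
    (auto intro: square_integrable_add simp: square_integrable_def[of _ "\<lambda>_. 0"])

lemma square_integrable_bounded_mult:
  assumes X: "square_integrable M X" and G: "G \<in> borel_measurable M" and K: "AE x in M. \<bar>G x\<bar> \<le> K"
  shows "square_integrable M (\<lambda>x. G x * X x)"
  unfolding square_integrable_def
proof
  note [measurable] = square_integrableD(1)[OF X] G
  show "(\<lambda>x. G x * X x) \<in> borel_measurable M" by measurable
  show "integrable M (\<lambda>x. (G x * X x)\<^sup>2)"
  proof (rule Bochner_Integration.integrable_bound)
    show "integrable M (\<lambda>x. K\<^sup>2 * (X x)\<^sup>2)" using X by (simp add: square_integrable_def)
    have "norm ((G x * X x)\<^sup>2) \<le> norm (K\<^sup>2 * (X x)\<^sup>2)" if "\<bar>G x\<bar> \<le> K" for x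
    proof -
      have "(G x)\<^sup>2 \<le> K\<^sup>2" using that by (metis abs_ge_zero power2_abs power_mono)
      then show ?thesis by (simp add: power_mult_distrib mult_right_mono)
    qed
    then show "AE x in M. norm ((G x * X x)\<^sup>2) \<le> norm (K\<^sup>2 * (X x)\<^sup>2)" using K by auto
  qed simp
qed

lemma (in finite_measure) square_integrable_bounded:
  assumes "X \<in> borel_measurable M" "AE x in M. \<bar>X x\<bar> \<le> K"
  shows "square_integrable M X"
  using square_integrable_bounded_mult[of M "\<lambda>_. 1" X K] assms by (simp add: square_integrable_def)

text \<open>The error recursion without sensors, graph and filtration. Of the martingale structure
  only \<open>orth\<close> is retained; vanishing correlation in each coordinate suffices because
  the step sizes \<open>a\<close> are deterministic.\<close>

locale perturbed_recursion = prob_space P for P :: "'w measure" +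
  fixes n :: nat and K v :: real and e w u :: "nat \<Rightarrow> nat \<Rightarrow> 'w \<Rightarrow> real"
    and G :: "nat \<Rightarrow> nat \<Rightarrow> nat \<Rightarrow> 'w \<Rightarrow> real" and a :: "nat \<Rightarrow> nat \<Rightarrow> real" and \<phi> :: "nat \<Rightarrow> real"
  assumes e_si: "p < n \<Longrightarrow> square_integrable P (e t p)"
    and G_meas: "p < n \<Longrightarrow> q < n \<Longrightarrow> G t p q \<in> borel_measurable P"
    and G_bound: "p < n \<Longrightarrow> q < n \<Longrightarrow> AE \<omega> in P. \<bar>G t p q \<omega>\<bar> \<le> K" and K: "K \<ge> 0"
    and w_bound: "p < n \<Longrightarrow> AE \<omega> in P. \<bar>w t p \<omega>\<bar> \<le> \<phi> t"
    and u_si: "p < n \<Longrightarrow> square_integrable P (u t p)"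
    and u_bound: "(\<integral>\<omega>. (\<Sum>p<n. (u t p \<omega>)\<^sup>2) \<partial>P) \<le> v"
    and orth: "p < n \<Longrightarrow> (\<integral>\<omega>. e t p \<omega> * u t p \<omega> \<partial>P) = 0"
    and rec: "p < n \<Longrightarrow> e (Suc t) p \<omega> = e t p \<omega> + a t p * (w t p \<omega> + u t p \<omega> - (\<Sum>q<n. G t p q \<omega> * e t q \<omega>))"
begin

definition "\<kappa> = n * K + 1"

definition ms :: "nat \<Rightarrow> real" where
  "ms t = (\<integral>\<omega>. (\<Sum>p<n. (e t p \<omega>)\<^sup>2) \<partial>P)"

definition drift :: "nat \<Rightarrow> nat \<Rightarrow> real" where
  "drift s t = (\<integral>\<omega>. (\<Sum>p<n. (e t p \<omega> - e s p \<omega>)\<^sup>2) \<partial>P)"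

text \<open>The matrix is taken at time \<open>t\<close>, the error at the earlier time
  \<open>s\<close>: this mixture can be bounded from below by conditioning on the past of
  \<open>s\<close>.\<close>

definition gain :: "nat \<Rightarrow> nat \<Rightarrow> real" where
  "gain s t = (\<integral>\<omega>. (\<Sum>p<n. \<Sum>q<n. G t p q \<omega> * e s p \<omega> * e s q \<omega>) \<partial>P)"

lemma kappa_pos: "\<kappa> > 0" "n * K \<le> \<kappa>" using K by (auto simp: \<kappa>_def intro: add_nonneg_pos)

lemma ms_nonneg: "ms t \<ge> 0" and drift_nonneg: "drift s t \<ge> 0" and v_nonneg: "v \<ge> 0"
proof -
  show "ms t \<ge> 0" "drift s t \<ge> 0"
    unfolding ms_def drift_def by (auto intro!: integral_nonneg_AE sum_nonneg)
  have "0 \<le> (\<integral>\<omega>. (\<Sum>p<n. (u 0 p \<omega>)\<^sup>2) \<partial>P)" by (auto intro!: integral_nonneg_AE sum_nonneg)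
  then show "v \<ge> 0" using u_bound[of 0] by linarith
qed

lemma integrable_squares:
  "integrable P (\<lambda>\<omega>. \<Sum>p<n. (e t p \<omega>)\<^sup>2)"
  "integrable P (\<lambda>\<omega>. \<Sum>p<n. (u t p \<omega>)\<^sup>2)"
  "integrable P (\<lambda>\<omega>. \<Sum>p<n. (e t p \<omega> - e s p \<omega>)\<^sup>2)"
  using e_si u_si square_integrable_diff[OF e_si e_si]
  by (auto intro!: Bochner_Integration.integrable_sum square_integrableD)

lemma integrable_form: "integrable P (\<lambda>\<omega>. \<Sum>p<n. \<Sum>q<n. G t p q \<omega> * e s p \<omega> * e s q \<omega>)"
  using square_integrable_mult[OF square_integrable_bounded_mult[OF e_si G_meas G_bound] e_si]
  by (auto intro!: Bochner_Integration.integrable_sum)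

lemma integrable_cross: "p < n \<Longrightarrow> integrable P (\<lambda>\<omega>. e t p \<omega> * u t p \<omega>)"
  using square_integrable_mult[OF e_si u_si] by auto

lemma AE_bounds: "AE \<omega> in P. (\<forall>p<n. \<forall>q<n. \<bar>G t p q \<omega>\<bar> \<le> K) \<and> (\<forall>p<n. \<bar>w t p \<omega>\<bar> \<le> \<phi> t)"
proof -
  have "AE \<omega> in P. \<forall>p\<in>{..<n}. \<forall>q\<in>{..<n}. \<bar>G t p q \<omega>\<bar> \<le> K"
    by (intro AE_finite_allI) (auto intro: G_bound)
  moreover have "AE \<omega> in P. \<forall>p\<in>{..<n}. \<bar>w t p \<omega>\<bar> \<le> \<phi> t"
    by (intro AE_finite_allI) (auto intro: w_bound)
  ultimately show ?thesis by eventually_elim auto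
qed

lemma ms_le: "ms t \<le> 2 * ms s + 2 * drift s t"
proof -
  have "ms t \<le> (\<integral>\<omega>. 2 * (\<Sum>p<n. (e s p \<omega>)\<^sup>2) + 2 * (\<Sum>p<n. (e t p \<omega> - e s p \<omega>)\<^sup>2) \<partial>P)"
    unfolding ms_def
  proof (rule integral_mono)
    show "(\<Sum>p<n. (e t p \<omega>)\<^sup>2) \<le> 2 * (\<Sum>p<n. (e s p \<omega>)\<^sup>2) + 2 * (\<Sum>p<n. (e t p \<omega> - e s p \<omega>)\<^sup>2)" for \<omega>
      using sum_power2_add_le[of "\<lambda>p. e s p \<omega>" "\<lambda>p. e t p \<omega> - e s p \<omega>" n] by simp
  qed (use integrable_squares in auto)
  then show ?thesis using integrable_squares by (simp add: ms_def drift_def)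
qed

text \<open>The pointwise estimate with \<open>c\<close> frozen at time \<open>s\<close>,
  integrated. The term linear in the noise drops out by \<open>orth\<close>.\<close>

lemma ms_step:
  fixes b :: real
  assumes a: "\<And>p. p < n \<Longrightarrow> \<bar>a t p - b\<bar> \<le> \<epsilon> * b" and b: "0 \<le> b" and eps: "0 \<le> \<epsilon>" "\<epsilon> \<le> 1"
    and eta: "\<eta> > 0"
  shows "ms (Suc t) \<le> ms t - 2 * b * gain s t
      + b * (6 * \<eta> + 4 * \<epsilon> * \<kappa> + 24 * b * \<kappa>\<^sup>2) * ms s
      + b * (4 * \<epsilon> * \<kappa> + 2 * \<kappa> + 2 * \<kappa>\<^sup>2 / \<eta> + 4 * \<eta> + 24 * b * \<kappa>\<^sup>2) * drift s t
      + (2 * b * n * (\<phi> t)\<^sup>2 / \<eta> + 12 * b\<^sup>2 * n * (\<phi> t)\<^sup>2) + 12 * b\<^sup>2 * v"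
proof -
  define c1 where "c1 = b * (6 * \<eta> + 4 * \<epsilon> * \<kappa> + 24 * b * \<kappa>\<^sup>2)"
  define c2 where "c2 = b * (4 * \<epsilon> * \<kappa> + 2 * \<kappa> + 2 * \<kappa>\<^sup>2 / \<eta> + 4 * \<eta> + 24 * b * \<kappa>\<^sup>2)"
  define c3 where "c3 = 2 * b * n * (\<phi> t)\<^sup>2 / \<eta> + 12 * b\<^sup>2 * n * (\<phi> t)\<^sup>2"
  let ?R = "\<lambda>\<omega>. (\<Sum>p<n. (e t p \<omega>)\<^sup>2) + 2 * (\<Sum>p<n. a t p * (e t p \<omega> * u t p \<omega>))
      - 2 * b * (\<Sum>p<n. \<Sum>q<n. G t p q \<omega> * e s p \<omega> * e s q \<omega>)
      + c1 * (\<Sum>p<n. (e s p \<omega>)\<^sup>2) + c2 * (\<Sum>p<n. (e t p \<omega> - e s p \<omega>)\<^sup>2) + c3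
      + 12 * b\<^sup>2 * (\<Sum>p<n. (u t p \<omega>)\<^sup>2)"
  have icross: "integrable P (\<lambda>\<omega>. \<Sum>p<n. a t p * (e t p \<omega> * u t p \<omega>))"
    using integrable_cross by (intro Bochner_Integration.integrable_sum integrable_mult_right) auto
  have cross: "(\<integral>\<omega>. (\<Sum>p<n. a t p * (e t p \<omega> * u t p \<omega>)) \<partial>P) = 0"
    using integrable_cross orth by (subst Bochner_Integration.integral_sum) auto
  note int = integrable_squares integrable_form icross
  have "ms (Suc t) \<le> (\<integral>\<omega>. ?R \<omega> \<partial>P)"
    unfolding ms_def
  proof (rule integral_mono_AE)
    show "AE \<omega> in P. (\<Sum>p<n. (e (Suc t) p \<omega>)\<^sup>2) \<le> ?R \<omega>"
      using AE_bounds[of t]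
    proof eventually_elim
      case (elim \<omega>)
      have "(\<Sum>p<n. (e (Suc t) p \<omega>)\<^sup>2)
          = (\<Sum>p<n. (e t p \<omega> + a t p * (w t p \<omega> + u t p \<omega> - (\<Sum>q<n. G t p q \<omega> * e t q \<omega>)))\<^sup>2)"
        by (simp add: rec)
      also have "\<dots> \<le> ?R \<omega>"
        unfolding c1_def c2_def c3_def
        by (rule one_step_pointwise[where K = K]) (use elim K a b eps eta in \<open>auto simp: \<kappa>_def\<close>)
      finally show ?case .
    qed
  qed (use int in auto)
  also have "\<dots> = ms t - 2 * b * gain s t + c1 * ms s + c2 * drift s t + c3
      + 12 * b\<^sup>2 * (\<integral>\<omega>. (\<Sum>p<n. (u t p \<omega>)\<^sup>2) \<partial>P)"
    using int by (simp add: ms_def gain_def drift_def cross prob_space)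
  also have "\<dots> \<le> ms t - 2 * b * gain s t + c1 * ms s + c2 * drift s t + c3 + 12 * b\<^sup>2 * v"
    using u_bound[of t] by (intro add_left_mono mult_left_mono) auto
  finally show ?thesis unfolding c1_def c2_def c3_def .
qed

text \<open>One constant dominating all coefficients in \<open>drift_step\<close>: 2 and 24 = 2 * 12
  come from splitting the new drift into old drift and increment, 48 = 24 * 2 from bounding
  \<open>ms t\<close> by \<open>ms s\<close> and the drift.\<close>

definition "growth = 2 + 48 * \<kappa>\<^sup>2 + 24 * (n + v)"

lemma growth_ge: "growth \<ge> 2" using v_nonneg by (simp add: growth_def)

lemma drift_step:
  fixes b :: real
  assumes a: "\<And>p. p < n \<Longrightarrow> \<bar>a t p\<bar> \<le> 2 * b" and b: "0 \<le> b" "b \<le> 1" and phi: "\<bar>\<phi> t\<bar> \<le> 1"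
  shows "drift s (Suc t) \<le> growth * drift s t + growth * (b\<^sup>2 * (ms s + 1))"
proof -
  have b2: "b\<^sup>2 \<le> 1" using b by (simp add: power_le_one)
  let ?I = "\<lambda>\<omega> p. a t p * (w t p \<omega> + u t p \<omega> - (\<Sum>q<n. G t p q \<omega> * e t q \<omega>))"
  let ?R = "\<lambda>\<omega>. 2 * (\<Sum>p<n. (e t p \<omega> - e s p \<omega>)\<^sup>2)
    + 2 * (12 * b\<^sup>2 * (n + (\<Sum>p<n. (u t p \<omega>)\<^sup>2) + \<kappa>\<^sup>2 * (\<Sum>p<n. (e t p \<omega>)\<^sup>2)))"
  have "drift s (Suc t) \<le> (\<integral>\<omega>. ?R \<omega> \<partial>P)"
    unfolding drift_def
  proof (rule integral_mono_AE)
    show "AE \<omega> in P. (\<Sum>p<n. (e (Suc t) p \<omega> - e s p \<omega>)\<^sup>2) \<le> ?R \<omega>"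
      using AE_bounds[of t]
    proof eventually_elim
      case (elim \<omega>)
      have "(\<Sum>p<n. (e (Suc t) p \<omega> - e s p \<omega>)\<^sup>2) = (\<Sum>p<n. ((e t p \<omega> - e s p \<omega>) + ?I \<omega> p)\<^sup>2)"
        by (intro sum.cong) (auto simp: rec algebra_simps)
      also have "\<dots> \<le> 2 * (\<Sum>p<n. (e t p \<omega> - e s p \<omega>)\<^sup>2) + 2 * (\<Sum>p<n. (?I \<omega> p)\<^sup>2)"
        by (rule sum_power2_add_le)
      also have "(\<Sum>p<n. (?I \<omega> p)\<^sup>2)
          \<le> 12 * b\<^sup>2 * (n * (\<phi> t)\<^sup>2 + (\<Sum>p<n. (u t p \<omega>)\<^sup>2) + (n * K)\<^sup>2 * (\<Sum>p<n. (e t p \<omega>)\<^sup>2))"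
        by (rule increment_square_bound) (use elim K a b in auto)
      also have "\<dots> \<le> 12 * b\<^sup>2 * (real n * 1 + (\<Sum>p<n. (u t p \<omega>)\<^sup>2) + \<kappa>\<^sup>2 * (\<Sum>p<n. (e t p \<omega>)\<^sup>2))"
      proof (intro mult_left_mono add_mono mult_right_mono power_mono sum_nonneg)
        show "(\<phi> t)\<^sup>2 \<le> 1" using phi by (simp add: abs_square_le_1)
      qed (use kappa_pos K in auto)
      finally show ?case by simp
    qed
  qed (use integrable_squares in auto)
  also have "\<dots> = 2 * drift s t + 24 * b\<^sup>2 * (n + (\<integral>\<omega>. (\<Sum>p<n. (u t p \<omega>)\<^sup>2) \<partial>P) + \<kappa>\<^sup>2 * ms t)"
    using integrable_squares by (simp add: drift_def ms_def prob_space algebra_simps)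
  also have "\<dots> \<le> 2 * drift s t + 24 * b\<^sup>2 * (n + v + \<kappa>\<^sup>2 * (2 * ms s + 2 * drift s t))"
    using u_bound ms_le by (intro add_left_mono mult_left_mono add_mono) auto
  also have "\<dots> = 2 * drift s t + b\<^sup>2 * (48 * \<kappa>\<^sup>2 * drift s t) + b\<^sup>2 * (24 * (n + v) + 48 * \<kappa>\<^sup>2 * ms s)"
    by (simp add: algebra_simps)
  also have "b\<^sup>2 * (48 * \<kappa>\<^sup>2 * drift s t) \<le> 1 * (48 * \<kappa>\<^sup>2 * drift s t)"
    using b2 drift_nonneg by (intro mult_right_mono) auto
  also have "b\<^sup>2 * (24 * (n + v) + 48 * \<kappa>\<^sup>2 * ms s) \<le> b\<^sup>2 * (growth * 1 + growth * ms s)"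
    using ms_nonneg v_nonneg by (intro mult_left_mono add_mono mult_right_mono) (auto simp: growth_def)
  also have "2 * drift s t + 1 * (48 * \<kappa>\<^sup>2 * drift s t) \<le> growth * drift s t"
    unfolding growth_def distrib_right using drift_nonneg[of s t] v_nonneg by simp
  finally show ?thesis by (simp add: algebra_simps)
qed

text \<open>The crude geometric factor is affordable because \<open>j\<close> is at most the fixed
  block length in the applications. Subtracting 1 matches \<open>drift s s = 0\<close> and leaves
  room for the inhomogeneous term in the induction.\<close>

lemma drift_bound:
  fixes b :: real
  assumes a: "\<And>i p. i < j \<Longrightarrow> p < n \<Longrightarrow> \<bar>a (s + i) p\<bar> \<le> 2 * b" and b: "0 \<le> b" "b \<le> 1"
    and phi: "\<And>i. i < j \<Longrightarrow> \<bar>\<phi> (s + i)\<bar> \<le> 1"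
  shows "drift s (s + j) \<le> ((1 + growth) ^ j - 1) * (b\<^sup>2 * (ms s + 1))"
  using a phi
proof (induction j)
  case 0
  show ?case by (simp add: drift_def)
next
  case (Suc j)
  let ?X = "b\<^sup>2 * (ms s + 1)"
  have "drift s (s + Suc j) \<le> growth * drift s (s + j) + growth * ?X"
    using drift_step[of "s + j" b s] Suc.prems b by simp
  also have "\<dots> \<le> growth * (((1 + growth) ^ j - 1) * ?X) + growth * ?X"
    using Suc.IH Suc.prems growth_ge by (intro add_right_mono mult_left_mono) auto
  also have "\<dots> = growth * (1 + growth) ^ j * ?X" by (simp add: algebra_simps)
  also have "\<dots> \<le> ((1 + growth) ^ Suc j - 1) * ?X"
    using ms_nonneg growth_ge by (intro mult_right_mono) (auto simp: algebra_simps)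
  finally show ?case .
qed

text \<open>All \<open>j\<close> steps refer to the same frozen time \<open>s\<close>, so the gains
  add up to the sum controlled by condition (ii.c). The drift is of order \<open>b\<^sup>2\<close>
  and, multiplied by a coefficient of order \<open>b\<close>, contributes only order
  \<open>b ^ 3\<close>.\<close>

lemma ms_block:
  fixes b :: real
  assumes a: "\<And>i p. i < j \<Longrightarrow> p < n \<Longrightarrow> \<bar>a (s + i) p - b\<bar> \<le> \<epsilon> * b"
    and b: "0 \<le> b" "b \<le> 1" and eps: "0 \<le> \<epsilon>" "\<epsilon> \<le> 1"
    and phi: "\<And>i. i < j \<Longrightarrow> \<bar>\<phi> (s + i)\<bar> \<le> 1" and eta: "\<eta> > 0"
  shows "ms (s + j) \<le> ms s - 2 * b * (\<Sum>i<j. gain s (s + i))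
      + j * (b * (6 * \<eta> + 4 * \<epsilon> * \<kappa> + 24 * b * \<kappa>\<^sup>2) * ms s
        + b * (6 * \<kappa> + 2 * \<kappa>\<^sup>2 / \<eta> + 4 * \<eta> + 24 * \<kappa>\<^sup>2) * ((1 + growth) ^ j * (b\<^sup>2 * (ms s + 1)))
        + 12 * b\<^sup>2 * v)
      + (\<Sum>i<j. 2 * b * n * (\<phi> (s + i))\<^sup>2 / \<eta> + 12 * b\<^sup>2 * n * (\<phi> (s + i))\<^sup>2)"
proof -
  define c1 where "c1 = b * (6 * \<eta> + 4 * \<epsilon> * \<kappa> + 24 * b * \<kappa>\<^sup>2)"
  define c2 where "c2 = b * (6 * \<kappa> + 2 * \<kappa>\<^sup>2 / \<eta> + 4 * \<eta> + 24 * \<kappa>\<^sup>2)"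
  define Y where "Y = (1 + growth) ^ j * (b\<^sup>2 * (ms s + 1))"
  define c3 where "c3 i = 2 * b * n * (\<phi> (s + i))\<^sup>2 / \<eta> + 12 * b\<^sup>2 * n * (\<phi> (s + i))\<^sup>2" for i
  have X0: "0 \<le> b\<^sup>2 * (ms s + 1)" using ms_nonneg[of s] by (intro mult_nonneg_nonneg) auto
  have a2: "\<bar>a (s + i) p\<bar> \<le> 2 * b" if "i < j" "p < n" for i p
  proof -
    have "\<epsilon> * b \<le> 1 * b" using eps b by (intro mult_right_mono) auto
    then show ?thesis using a[OF that] b by linarith
  qed
  have c20: "c2 \<ge> 0" unfolding c2_def using b kappa_pos eta by auto
  have step: "ms (s + Suc i) \<le> ms (s + i) - 2 * b * gain s (s + i) + (c1 * ms s + c2 * Y + 12 * b\<^sup>2 * v) + c3 i"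
    if i: "i < j" for i
  proof -
    have "drift s (s + i) \<le> ((1 + growth) ^ i - 1) * (b\<^sup>2 * (ms s + 1))"
      by (rule drift_bound) (use a2 b phi i in auto)
    also have "\<dots> \<le> (1 + growth) ^ j * (b\<^sup>2 * (ms s + 1))"
    proof (intro mult_right_mono X0)
      have "(1 + growth) ^ i \<le> (1 + growth) ^ j" using growth_ge i by (intro power_increasing) auto
      then show "(1 + growth) ^ i - 1 \<le> (1 + growth) ^ j" by simp
    qed
    finally have d: "drift s (s + i) \<le> Y" unfolding Y_def .
    have "\<epsilon> * \<kappa> \<le> 1 * \<kappa>" "b * \<kappa>\<^sup>2 \<le> 1 * \<kappa>\<^sup>2" using eps b kappa_pos by (intro mult_right_mono; simp)+
    then have "b * (4 * \<epsilon> * \<kappa> + 2 * \<kappa> + 2 * \<kappa>\<^sup>2 / \<eta> + 4 * \<eta> + 24 * b * \<kappa>\<^sup>2) \<le> c2"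
      unfolding c2_def using b by (intro mult_left_mono) auto
    then have "b * (4 * \<epsilon> * \<kappa> + 2 * \<kappa> + 2 * \<kappa>\<^sup>2 / \<eta> + 4 * \<eta> + 24 * b * \<kappa>\<^sup>2) * drift s (s + i) \<le> c2 * Y"
      using d c20 drift_nonneg by (intro mult_mono) auto
    then show ?thesis
      using ms_step[OF a[OF i] b(1) eps eta, of s] by (simp add: c1_def c3_def)
  qed
  have "ms (s + i) \<le> ms s - 2 * b * (\<Sum>l<i. gain s (s + l))
      + i * (c1 * ms s + c2 * Y + 12 * b\<^sup>2 * v) + (\<Sum>l<i. c3 l)" if "i \<le> j" for i
    using that
  proof (induction i)
    case (Suc i)
    then show ?case using step[of i] by (simp add: algebra_simps)
  qed simp
  from this[of j] show ?thesis unfolding c1_def c2_def c3_def Y_def by simp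
qed

end

section \<open>Scaled mean-square convergence\<close>

text \<open>Bernoulli's inequality for exponents between 0 and 1, from Young's inequality for
  \<open>x\<close> and 1. It linearises the ratio of the normalisations of successive
  blocks.\<close>

lemma powr_le_affine:
  fixes x s :: real
  assumes "x > 0" "0 \<le> s" "s \<le> 1"
  shows "x powr s \<le> 1 + s * (x - 1)"
  using Youngs_inequality_0[of s "1 - s" x 1] assms by (simp add: algebra_simps)

lemma filterlim_div_nat_at_top:
  assumes "h > (0::nat)" shows "filterlim (\<lambda>t. t div h) at_top sequentially"
  unfolding filterlim_at_top eventually_sequentially
proof
  fix Z :: nat
  have "Z \<le> t div h" if "t \<ge> Z * h" for t
    using div_le_mono[OF that, of h] assms by simp
  then show "\<exists>N. \<forall>t\<ge>N. Z \<le> t div h" by blast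
qed

text \<open>For one step, \<open>\<alpha> t / \<alpha> (Suc t) = 1 + \<alpha> t * (1 / \<alpha> (Suc
  t) - 1 / \<alpha> t)\<close>, a null sequence times a convergent one added to 1; \<open>j\<close>
  steps multiply \<open>j\<close> such ratios.\<close>

lemma ratio_shift_tendsto_1:
  fixes \<alpha> :: "nat \<Rightarrow> real"
  assumes pos: "\<And>t. \<alpha> t > 0" and "\<alpha> \<longlonglongrightarrow> 0" and "(\<lambda>t. 1 / \<alpha> (Suc t) - 1 / \<alpha> t) \<longlonglongrightarrow> \<alpha>0"
  shows "(\<lambda>t. \<alpha> t / \<alpha> (t + j)) \<longlonglongrightarrow> 1"
proof (induction j)
  case 0
  show ?case using pos by (simp add: less_imp_neq[symmetric])
next
  case (Suc j)
  have "(\<lambda>t. 1 + \<alpha> t * (1 / \<alpha> (Suc t) - 1 / \<alpha> t)) \<longlonglongrightarrow> 1 + 0 * \<alpha>0"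
    by (intro tendsto_intros assms)
  moreover have "1 + \<alpha> t * (1 / \<alpha> (Suc t) - 1 / \<alpha> t) = \<alpha> t / \<alpha> (Suc t)" for t
    using pos[of t] by (simp add: field_simps)
  ultimately have "(\<lambda>t. \<alpha> t / \<alpha> (Suc t)) \<longlonglongrightarrow> 1" by simp
  then have "(\<lambda>t. \<alpha> (t + j) / \<alpha> (Suc (t + j))) \<longlonglongrightarrow> 1" by (rule LIMSEQ_ignore_initial_segment)
  from tendsto_mult[OF Suc this] show ?case
    using pos by (simp add: less_imp_neq[symmetric])
qed

lemma inverse_difference_shift_tendsto:
  fixes \<alpha> :: "nat \<Rightarrow> real"
  assumes "(\<lambda>t. 1 / \<alpha> (Suc t) - 1 / \<alpha> t) \<longlonglongrightarrow> \<alpha>0"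
  shows "(\<lambda>t. 1 / \<alpha> (t + j) - 1 / \<alpha> t) \<longlonglongrightarrow> j * \<alpha>0"
proof (induction j)
  case (Suc j)
  have "(\<lambda>t. 1 / \<alpha> (Suc (t + j)) - 1 / \<alpha> (t + j)) \<longlonglongrightarrow> \<alpha>0"
    by (rule LIMSEQ_ignore_initial_segment[OF assms])
  from tendsto_add[OF Suc this] show ?case by (simp add: algebra_simps)
qed simp

text \<open>Serves both to cut time into blocks and to split a stacked index into sensor and
  coordinate.\<close>

lemma sum_product_index:
  fixes f :: "nat \<Rightarrow> real"
  shows "(\<Sum>q<n * k. f q) = (\<Sum>i<n. \<Sum>j<k. f (i * k + j))"
proof -
  have "sum f {i * k..<i * k + k} = (\<Sum>j<k. f (i * k + j))" for i
    by (simp add: sum.atLeastLessThan_shift_0[of _ "i * k"] lessThan_atLeast0)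
  then show ?thesis by (simp flip: sum.nat_group)
qed

text \<open>Used contrapositively: the step sizes at block starts inherit divergence from
  \<open>\<alpha>\<close>. As ratios within a block tend to 1, each residue class modulo
  \<open>h\<close> is eventually dominated by twice the class of the block starts.\<close>

lemma summable_subsampled:
  fixes \<alpha> :: "nat \<Rightarrow> real"
  assumes pos: "\<And>t. \<alpha> t > 0" and h: "h > 0"
    and ratio: "\<And>j. (\<lambda>k. \<alpha> (k * h) / \<alpha> (k * h + j)) \<longlonglongrightarrow> 1"
    and sm: "summable (\<lambda>k. \<alpha> (k * h))"
  shows "summable \<alpha>"
proof -
  have sj: "summable (\<lambda>k. \<alpha> (k * h + j))" for j
  proof (rule summable_comparison_test_ev)
    have "\<forall>\<^sub>F k in sequentially. \<alpha> (k * h) / \<alpha> (k * h + j) > 1 / 2"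
      by (rule order_tendstoD[OF ratio]) simp
    then show "\<forall>\<^sub>F k in sequentially. norm (\<alpha> (k * h + j)) \<le> 2 * \<alpha> (k * h)"
      by eventually_elim (use pos in \<open>auto simp: field_simps less_imp_le\<close>)
    show "summable (\<lambda>k. 2 * \<alpha> (k * h))" using sm by (rule summable_mult)
  qed
  show ?thesis
  proof (rule summableI_nonneg_bounded)
    fix T :: nat
    have "(\<Sum>t<T. \<alpha> t) \<le> (\<Sum>t<T * h. \<alpha> t)"
      using h pos by (intro sum_mono2) (auto simp: less_imp_le order_less_le_trans)
    also have "\<dots> = (\<Sum>k<T. \<Sum>j<h. \<alpha> (k * h + j))" by (rule sum_product_index)
    also have "\<dots> = (\<Sum>j<h. \<Sum>k<T. \<alpha> (k * h + j))" by (rule sum.swap)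
    also have "\<dots> \<le> (\<Sum>j<h. \<Sum>k. \<alpha> (k * h + j))"
      using pos by (intro sum_mono sum_le_suminf sj) (auto simp: less_imp_le)
    finally show "(\<Sum>t<T. \<alpha> t) \<le> (\<Sum>j<h. \<Sum>k. \<alpha> (k * h + j))" .
  qed (use pos in \<open>auto simp: less_imp_le\<close>)
qed

text \<open>Contraction is available only from one block start to the next, so the limit is obtained
  for \<open>U\<close> along multiples of \<open>h\<close> and carried into the blocks by the drift
  bound.\<close>

theorem (in perturbed_recursion) scaled_mean_square_tendsto_zero:
  fixes \<alpha> :: "nat \<Rightarrow> real" and \<alpha>0 \<delta> lam :: real and h :: nat
  assumes pos: "\<And>t. \<alpha> t > 0" and lim: "\<alpha> \<longlonglongrightarrow> 0" and div: "\<not> summable \<alpha>"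
    and diff: "(\<lambda>t. 1 / \<alpha> (Suc t) - 1 / \<alpha> t) \<longlonglongrightarrow> \<alpha>0"
    and steps: "\<And>p. p < n \<Longrightarrow> (\<lambda>t. a t p / \<alpha> t) \<longlonglongrightarrow> 1"
    and phi: "(\<lambda>t. \<phi> t / \<alpha> t powr \<delta>) \<longlonglongrightarrow> 0" and delta: "0 \<le> \<delta>" "\<delta> < 1 / 2"
    and h: "h > 0" and lam: "lam > 0"
    and coercive: "\<And>k. (lam + h * \<alpha>0 * \<delta>) * ms (k * h) \<le> (\<Sum>j<h. gain (k * h) (k * h + j))"
  shows "(\<lambda>t. ms t / \<alpha> t powr (2 * \<delta>)) \<longlonglongrightarrow> 0"
proof -
  have nz: "\<alpha> t \<noteq> 0" for t using pos[of t] by simp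
  define \<beta> where "\<beta> k = \<alpha> (k * h)" for k
  \<comment> \<open>Chosen so that the losses from Young's inequality over a block sum to
    \<open>h * (6 * \<eta>) = lam / 2\<close>.\<close>
  define \<eta> where "\<eta> = lam / (12 * h)"
  define \<epsilon> where "\<epsilon> k = (\<Sum>j<h. \<Sum>p<n. \<bar>a (k * h + j) p / \<beta> k - 1\<bar>)" for k
  define x where "x k = \<beta> k / \<beta> (Suc k)" for k
  define C where "C = 6 * \<kappa> + 2 * \<kappa>\<^sup>2 / \<eta> + 4 * \<eta> + 24 * \<kappa>\<^sup>2"
  define L where "L = (1 + growth) ^ h"
  define c where "c = lam + h * \<alpha>0 * \<delta>"
  \<comment> \<open>\<open>1 + \<beta> k * z k\<close> bounds the change of normalisation
    \<open>x k powr (2 * \<delta>)\<close>, and \<open>1 + \<beta> k * z' k\<close> is the factor of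
    the mean square over a block. The limit \<open>2 * \<delta> * (h * \<alpha>0)\<close> of
    \<open>z\<close> is exactly cancelled by the surplus \<open>h * \<alpha>0 * \<delta>\<close> in
    \<open>c\<close>, which enters \<open>z'\<close> with factor -2.\<close>
  define z where "z k = 2 * \<delta> * (1 / \<beta> (Suc k) - 1 / \<beta> k)" for k
  define z' where "z' k = h * (6 * \<eta> + 4 * \<epsilon> k * \<kappa> + 24 * \<beta> k * \<kappa>\<^sup>2 + C * L * (\<beta> k)\<^sup>2) - 2 * c" for k
  define Gn where "Gn k = h * (C * L * (\<beta> k)\<^sup>2 + 12 * \<beta> k * v)
      + (\<Sum>j<h. 2 * n * (\<phi> (k * h + j))\<^sup>2 / \<eta> + 12 * \<beta> k * n * (\<phi> (k * h + j))\<^sup>2)" for k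
  define g where "g k = Gn k / \<beta> k powr (2 * \<delta>)" for k
  define U where "U k = ms (k * h) / \<beta> k powr (2 * \<delta>)" for k
  have eta: "\<eta> > 0" using lam h by (simp add: \<eta>_def)
  have bpos: "\<beta> k > 0" for k using pos by (simp add: \<beta>_def)
  have CL: "C \<ge> 0" "L \<ge> 0" using kappa_pos eta growth_ge by (auto simp: C_def L_def)
  have khj: "filterlim (\<lambda>k. k * h + j) at_top sequentially" for j
    using h by (intro filterlim_compose[OF filterlim_add_const_nat_at_top mult_nat_right_at_top])
  note sub = filterlim_compose[OF _ khj]
  have sub0: "filterlim (\<lambda>k. f (k * h)) F sequentially" if "filterlim f F sequentially" for f :: "nat \<Rightarrow> real" and F
    using sub[OF that, of 0] by simp
  have blim: "\<beta> \<longlonglongrightarrow> 0" unfolding \<beta>_def by (rule sub0[OF lim])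
  have rj: "(\<lambda>k. \<alpha> (k * h) / \<alpha> (k * h + j)) \<longlonglongrightarrow> 1" for j
    using sub0[OF ratio_shift_tendsto_1[OF pos lim diff, of j]] .
  have rj': "(\<lambda>k. \<alpha> (k * h + j) / \<beta> k) \<longlonglongrightarrow> 1" for j
    using tendsto_inverse[OF rj[of j]] by (simp add: \<beta>_def)
  have bdiv: "\<not> summable \<beta>"
    using summable_subsampled[OF pos h rj] div unfolding \<beta>_def by blast
  have elim: "\<epsilon> \<longlonglongrightarrow> 0"
  proof -
    have "(\<lambda>k. a (k * h + j) p / \<beta> k) \<longlonglongrightarrow> 1" if "p < n" for j p
      using tendsto_mult[OF sub[OF steps[OF that], of j] rj'[of j]] nz by simp
    then have "\<epsilon> \<longlonglongrightarrow> (\<Sum>j<h. \<Sum>p<n. \<bar>1 - 1\<bar>)" unfolding \<epsilon>_def by (intro tendsto_intros) auto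
    then show ?thesis by simp
  qed
  have eps0: "\<epsilon> k \<ge> 0" for k unfolding \<epsilon>_def by (intro sum_nonneg) auto
  have aeps: "\<bar>a (k * h + j) p - \<beta> k\<bar> \<le> \<epsilon> k * \<beta> k" if "j < h" "p < n" for k j p
  proof -
    have "\<bar>a (k * h + j) p / \<beta> k - 1\<bar> \<le> (\<Sum>p<n. \<bar>a (k * h + j) p / \<beta> k - 1\<bar>)"
      using that by (intro member_le_sum) auto
    also have "\<dots> \<le> \<epsilon> k" unfolding \<epsilon>_def using that by (intro member_le_sum) (auto intro: sum_nonneg)
    finally have "\<bar>a (k * h + j) p / \<beta> k - 1\<bar> * \<beta> k \<le> \<epsilon> k * \<beta> k"
      using bpos[of k] by (intro mult_right_mono) auto
    moreover have "\<bar>a (k * h + j) p / \<beta> k - 1\<bar> * \<beta> k = \<bar>(a (k * h + j) p / \<beta> k - 1) * \<beta> k\<bar>"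
      using bpos[of k] by (simp add: abs_mult)
    moreover have "(a (k * h + j) p / \<beta> k - 1) * \<beta> k = a (k * h + j) p - \<beta> k"
      using bpos[of k] by (simp add: field_simps)
    ultimately show ?thesis by simp
  qed
  have "\<forall>\<^sub>F t in sequentially. \<bar>\<phi> t\<bar> \<le> 1"
  proof -
    have "\<forall>\<^sub>F t in sequentially. \<alpha> t < 1" "\<forall>\<^sub>F t in sequentially. \<bar>\<phi> t / \<alpha> t powr \<delta>\<bar> < 1"
      using order_tendstoD(2)[OF lim, of 1] order_tendstoD(2)[OF tendsto_rabs_zero[OF phi], of 1] by auto
    then show ?thesis
    proof eventually_elim
      case (elim t)
      have "\<alpha> t powr \<delta> \<le> 1" using elim pos[of t] delta by (simp add: powr_le1)
      moreover have "\<alpha> t powr \<delta> > 0" using pos[of t] by simp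
      ultimately show ?case using elim(2) by (simp add: field_simps abs_divide)
    qed
  qed
  then have "\<forall>\<^sub>F k in sequentially. \<bar>\<phi> (k * h + j)\<bar> \<le> 1" for j
    using eventually_compose_filterlim[OF _ khj] by blast
  then have phi1: "\<forall>\<^sub>F k in sequentially. \<forall>j\<in>{..<h}. \<bar>\<phi> (k * h + j)\<bar> \<le> 1"
    by (intro eventually_ball_finite) auto
  have "\<forall>\<^sub>F k in sequentially. \<beta> k < 1" "\<forall>\<^sub>F k in sequentially. \<epsilon> k < 1"
    using order_tendstoD(2)[OF blim, of 1] order_tendstoD(2)[OF elim, of 1] by auto
  with phi1 have good: "\<forall>\<^sub>F k in sequentially. \<beta> k \<le> 1 \<and> \<epsilon> k \<le> 1 \<and> (\<forall>j<h. \<bar>\<phi> (k * h + j)\<bar> \<le> 1)"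
    by eventually_elim auto
  \<comment> \<open>Here \<open>\<delta> < 1 / 2\<close> makes the noise contribution vanish after
    normalisation.\<close>
  have bp: "(\<lambda>k. \<beta> k / \<beta> k powr (2 * \<delta>)) \<longlonglongrightarrow> 0"
  proof -
    have "(\<lambda>k. \<beta> k powr (1 - 2 * \<delta>)) \<longlonglongrightarrow> 0"
      using delta bpos by (intro tendsto_zero_powrI[OF blim tendsto_const]) (auto simp: less_imp_le)
    then show ?thesis using bpos by (simp add: powr_diff less_imp_le)
  qed
  have b2p: "(\<lambda>k. (\<beta> k)\<^sup>2 / \<beta> k powr (2 * \<delta>)) \<longlonglongrightarrow> 0"
    using tendsto_mult[OF blim bp] by (simp add: power2_eq_square)
  have php: "(\<lambda>k. (\<phi> (k * h + j))\<^sup>2 / \<beta> k powr (2 * \<delta>)) \<longlonglongrightarrow> 0" for j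
  proof -
    \<comment> \<open>The hypothesis on \<open>\<phi>\<close> is normalised at time
      \<open>k * h + j\<close>; the second factor, which tends to 1, moves the normalisation to the
      block start.\<close>
    have "(\<lambda>k. (\<phi> (k * h + j) / \<alpha> (k * h + j) powr \<delta>)\<^sup>2 * (\<alpha> (k * h + j) / \<beta> k) powr (2 * \<delta>))
        \<longlonglongrightarrow> 0\<^sup>2 * 1 powr (2 * \<delta>)"
      by (intro tendsto_intros sub[OF phi, of j] rj') auto
    moreover have "(\<phi> (k * h + j) / \<alpha> (k * h + j) powr \<delta>)\<^sup>2 * (\<alpha> (k * h + j) / \<beta> k) powr (2 * \<delta>)
        = (\<phi> (k * h + j))\<^sup>2 / \<beta> k powr (2 * \<delta>)" for k
    proof -
      have "(\<alpha> (k * h + j) powr \<delta>)\<^sup>2 = \<alpha> (k * h + j) powr (2 * \<delta>)"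
        by (simp add: power2_eq_square powr_add[symmetric])
      moreover have "\<alpha> (k * h + j) powr (2 * \<delta>) \<noteq> 0" using nz by simp
      ultimately show ?thesis
        using pos bpos by (simp add: power_divide powr_divide less_imp_le)
    qed
    ultimately show ?thesis by simp
  qed
  have glim: "g \<longlonglongrightarrow> 0"
  proof -
    have geq: "g = (\<lambda>k. h * (C * L * ((\<beta> k)\<^sup>2 / \<beta> k powr (2 * \<delta>)) + 12 * v * (\<beta> k / \<beta> k powr (2 * \<delta>)))
      + (\<Sum>j<h. 2 * n / \<eta> * ((\<phi> (k * h + j))\<^sup>2 / \<beta> k powr (2 * \<delta>))
          + 12 * real n * (\<beta> k * ((\<phi> (k * h + j))\<^sup>2 / \<beta> k powr (2 * \<delta>)))))"
      unfolding g_def Gn_def by (rule ext) (simp add: add_divide_distrib sum_divide_distrib algebra_simps)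
    have "g \<longlonglongrightarrow> h * (C * L * 0 + 12 * v * 0) + (\<Sum>j<h. 2 * n / \<eta> * 0 + 12 * real n * (0 * 0))"
      unfolding geq by (intro tendsto_intros b2p bp php blim)
    then show ?thesis by simp
  qed
  have g0: "g k \<ge> 0" for k
    unfolding g_def Gn_def using CL bpos[of k] eta v_nonneg
    by (intro divide_nonneg_nonneg add_nonneg_nonneg mult_nonneg_nonneg sum_nonneg) auto
  have zlim: "z \<longlonglongrightarrow> 2 * \<delta> * (h * \<alpha>0)"
  proof -
    have "(\<lambda>k. 1 / \<alpha> (k * h + h) - 1 / \<alpha> (k * h)) \<longlonglongrightarrow> h * \<alpha>0"
      by (rule sub0[OF inverse_difference_shift_tendsto[OF diff, of h]])
    then show ?thesis unfolding z_def \<beta>_def by (intro tendsto_intros) (simp add: add.commute)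
  qed
  have z'lim: "z' \<longlonglongrightarrow> h * (6 * \<eta> + 4 * 0 * \<kappa> + 24 * 0 * \<kappa>\<^sup>2 + C * L * 0\<^sup>2) - 2 * c"
    unfolding z'_def by (intro tendsto_intros elim blim)
  have "(\<lambda>k. z k + z' k + \<beta> k * z k * z' k) \<longlonglongrightarrow> 2 * \<delta> * (h * \<alpha>0)
      + (h * (6 * \<eta> + 4 * 0 * \<kappa> + 24 * 0 * \<kappa>\<^sup>2 + C * L * 0\<^sup>2) - 2 * c) + 0 * (2 * \<delta> * (h * \<alpha>0))
      * (h * (6 * \<eta> + 4 * 0 * \<kappa> + 24 * 0 * \<kappa>\<^sup>2 + C * L * 0\<^sup>2) - 2 * c)"
    by (intro tendsto_intros zlim z'lim blim)
  \<comment> \<open>With the choice of \<open>\<eta>\<close> this is \<open>2 * \<delta> * h *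
    \<alpha>0 + lam / 2 - 2 * (lam + h * \<alpha>0 * \<delta>)\<close>. The limit lies strictly
    below \<open>- lam\<close>, so the rate \<open>lam\<close> holds eventually.\<close>
  also have "2 * \<delta> * (h * \<alpha>0)
      + (h * (6 * \<eta> + 4 * 0 * \<kappa> + 24 * 0 * \<kappa>\<^sup>2 + C * L * 0\<^sup>2) - 2 * c) + 0 * (2 * \<delta> * (h * \<alpha>0))
      * (h * (6 * \<eta> + 4 * 0 * \<kappa> + 24 * 0 * \<kappa>\<^sup>2 + C * L * 0\<^sup>2) - 2 * c) = - (3 / 2) * lam"
    using h by (simp add: \<eta>_def c_def field_simps)
  finally have neg: "\<forall>\<^sub>F k in sequentially. z k + z' k + \<beta> k * z k * z' k < - lam"
    by (rule order_tendstoD) (use lam in simp)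
  have "(\<lambda>k. 1 + \<beta> k * z' k) \<longlonglongrightarrow> 1 + 0 * (h * (6 * \<eta> + 4 * 0 * \<kappa> + 24 * 0 * \<kappa>\<^sup>2 + C * L * 0\<^sup>2) - 2 * c)"
    by (intro tendsto_intros z'lim blim)
  then have pos1: "\<forall>\<^sub>F k in sequentially. 0 < 1 + \<beta> k * z' k"
    by (rule order_tendstoD) simp
  have U0: "U k \<ge> 0" for k unfolding U_def using ms_nonneg by simp
  have Ulim: "U \<longlonglongrightarrow> 0"
  proof (rule stochastic_approximation_recursion[OF lam U0 _ blim bdiv])
    show "\<beta> k \<ge> 0" for k using bpos[of k] by simp
    have "(\<lambda>k. (1 + \<beta> k * z k) * g k) \<longlonglongrightarrow> (1 + 0 * (2 * \<delta> * (h * \<alpha>0))) * 0"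
      by (intro tendsto_intros blim zlim glim)
    then show "(\<lambda>k. (1 + \<beta> k * z k) * g k) \<longlonglongrightarrow> 0" by simp
    show "\<forall>\<^sub>F k in sequentially. U (Suc k) \<le> (1 - lam * \<beta> k) * U k + \<beta> k * ((1 + \<beta> k * z k) * g k)"
      using good neg pos1
    proof eventually_elim
      case (elim k)
      have bk: "0 \<le> \<beta> k" "\<beta> k \<le> 1" using bpos[of k] elim by auto
      have block: "ms (k * h + h) \<le> ms (k * h) - 2 * \<beta> k * (\<Sum>i<h. gain (k * h) (k * h + i))
        + h * (\<beta> k * (6 * \<eta> + 4 * \<epsilon> k * \<kappa> + 24 * \<beta> k * \<kappa>\<^sup>2) * ms (k * h)
        + \<beta> k * C * (L * ((\<beta> k)\<^sup>2 * (ms (k * h) + 1)))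
        + 12 * (\<beta> k)\<^sup>2 * v)
        + (\<Sum>i<h. 2 * \<beta> k * n * (\<phi> (k * h + i))\<^sup>2 / \<eta> + 12 * (\<beta> k)\<^sup>2 * n * (\<phi> (k * h + i))\<^sup>2)"
        unfolding C_def L_def
        by (rule ms_block) (use aeps bk eps0 elim eta in auto)
      have decrease: "2 * \<beta> k * (c * ms (k * h)) \<le> 2 * \<beta> k * (\<Sum>i<h. gain (k * h) (k * h + i))"
        using mult_left_mono[OF coercive[of k] bk(1)] by (simp add: c_def)
      have phis: "(\<Sum>i<h. 2 * \<beta> k * n * (\<phi> (k * h + i))\<^sup>2 / \<eta> + 12 * (\<beta> k)\<^sup>2 * n * (\<phi> (k * h + i))\<^sup>2)
        = \<beta> k * (\<Sum>j<h. 2 * n * (\<phi> (k * h + j))\<^sup>2 / \<eta> + 12 * \<beta> k * n * (\<phi> (k * h + j))\<^sup>2)"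
        by (simp add: sum_distrib_left algebra_simps power2_eq_square)
      have "ms (Suc k * h) \<le> (1 + \<beta> k * z' k) * ms (k * h) + \<beta> k * Gn k"
        using order_trans[OF block[unfolded phis] add_right_mono[OF add_right_mono[OF diff_left_mono[OF decrease]]]]
        unfolding z'_def Gn_def by (simp add: algebra_simps power2_eq_square)
      then have "ms (Suc k * h) / \<beta> k powr (2 * \<delta>)
          \<le> ((1 + \<beta> k * z' k) * ms (k * h) + \<beta> k * Gn k) / \<beta> k powr (2 * \<delta>)"
        by (intro divide_right_mono) auto
      then have 1: "ms (Suc k * h) / \<beta> k powr (2 * \<delta>) \<le> (1 + \<beta> k * z' k) * U k + \<beta> k * g k"
        by (simp add: U_def g_def add_divide_distrib)
      have "x k powr (2 * \<delta>) \<le> 1 + 2 * \<delta> * (x k - 1)"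
        using bpos delta by (intro powr_le_affine) (auto simp: x_def)
      also have "\<dots> = 1 + \<beta> k * z k"
        using bpos[of k] bpos[of "Suc k"] by (simp add: x_def z_def field_simps)
      finally have 2: "x k powr (2 * \<delta>) \<le> 1 + \<beta> k * z k" .
      have "U (Suc k) = x k powr (2 * \<delta>) * (ms (Suc k * h) / \<beta> k powr (2 * \<delta>))"
        using bpos[of k] bpos[of "Suc k"] by (simp add: U_def x_def powr_divide less_imp_le)
      also have "\<dots> \<le> (1 + \<beta> k * z k) * ((1 + \<beta> k * z' k) * U k + \<beta> k * g k)"
        using 1 2 ms_nonneg order_trans[OF powr_ge_zero 2] by (intro mult_mono) auto
      also have "\<dots> = (1 + \<beta> k * (z k + z' k + \<beta> k * z k * z' k)) * U k + \<beta> k * ((1 + \<beta> k * z k) * g k)"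
        by (simp add: algebra_simps)
      also have "\<dots> \<le> (1 + \<beta> k * (- lam)) * U k + \<beta> k * ((1 + \<beta> k * z k) * g k)"
        using elim bk U0 by (intro add_right_mono mult_right_mono add_left_mono mult_left_mono) auto
      finally show ?case by (simp add: mult.commute)
    qed
  qed
  \<comment> \<open>The scaled mean square along one residue class modulo \<open>h\<close>. Its
    value at any \<open>t\<close> is one of these at \<open>t div h\<close>, hence at most their
    sum, a finite sum of null sequences.\<close>
  define X where "X j k = ms (k * h + j) / \<alpha> (k * h + j) powr (2 * \<delta>)" for j k
  have Xlim: "X j \<longlonglongrightarrow> 0" if j: "j < h" for j
  proof (rule tendsto_sandwich[OF always_eventually])
    show "\<forall>k. 0 \<le> X j k" using ms_nonneg by (auto simp: X_def)
    let ?r = "\<lambda>k. \<alpha> (k * h) / \<alpha> (k * h + j)"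
    let ?B = "\<lambda>k. (2 * U k + 2 * L * ((\<beta> k)\<^sup>2 * U k + (\<beta> k)\<^sup>2 / \<beta> k powr (2 * \<delta>))) * ?r k powr (2 * \<delta>)"
    show "\<forall>\<^sub>F k in sequentially. X j k \<le> ?B k"
      using good
    proof eventually_elim
      case (elim k)
      have bk: "0 \<le> \<beta> k" "\<beta> k \<le> 1" using bpos[of k] elim by auto
      have a2: "\<bar>a (k * h + i) p\<bar> \<le> 2 * \<beta> k" if "i < h" "p < n" for i p
      proof -
        have "\<epsilon> k * \<beta> k \<le> 1 * \<beta> k" using elim bk by (intro mult_right_mono) auto
        then show ?thesis using aeps[OF that, of k] bk by linarith
      qed
      have "drift (k * h) (k * h + j) \<le> ((1 + growth) ^ j - 1) * ((\<beta> k)\<^sup>2 * (ms (k * h) + 1))"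
        by (rule drift_bound) (use a2 bk elim j in auto)
      also have "\<dots> \<le> L * ((\<beta> k)\<^sup>2 * (ms (k * h) + 1))"
      proof (intro mult_right_mono mult_nonneg_nonneg)
        have "(1 + growth) ^ j \<le> L" unfolding L_def using growth_ge j by (intro power_increasing) auto
        then show "(1 + growth) ^ j - 1 \<le> L" by simp
      qed (use ms_nonneg[of "k * h"] in auto)
      finally have "ms (k * h + j) \<le> 2 * ms (k * h) + 2 * (L * ((\<beta> k)\<^sup>2 * (ms (k * h) + 1)))"
        using ms_le[of "k * h + j" "k * h"] by linarith
      then have "ms (k * h + j) / \<beta> k powr (2 * \<delta>)
          \<le> (2 * ms (k * h) + 2 * (L * ((\<beta> k)\<^sup>2 * (ms (k * h) + 1)))) / \<beta> k powr (2 * \<delta>)"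
        by (intro divide_right_mono) auto
      also have "\<dots> = 2 * U k + 2 * L * ((\<beta> k)\<^sup>2 * U k + (\<beta> k)\<^sup>2 / \<beta> k powr (2 * \<delta>))"
        by (simp add: U_def add_divide_distrib algebra_simps)
      finally have "ms (k * h + j) / \<beta> k powr (2 * \<delta>) * ?r k powr (2 * \<delta>) \<le> ?B k"
        by (intro mult_right_mono) auto
      moreover have "ms (k * h + j) / \<beta> k powr (2 * \<delta>) * ?r k powr (2 * \<delta>) = X j k"
        using pos[of "k * h"] pos[of "k * h + j"] by (simp add: X_def \<beta>_def powr_divide less_imp_le)
      ultimately show ?case by simp
    qed
    have "?B \<longlonglongrightarrow> (2 * 0 + 2 * L * (0\<^sup>2 * 0 + 0)) * 1 powr (2 * \<delta>)"
      by (intro tendsto_intros Ulim blim b2p rj) auto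
    then show "?B \<longlonglongrightarrow> 0" by simp
  qed simp
  show ?thesis
  proof (rule tendsto_sandwich[OF always_eventually always_eventually])
    show "\<forall>t. 0 \<le> ms t / \<alpha> t powr (2 * \<delta>)" using ms_nonneg by auto
    show "\<forall>t. ms t / \<alpha> t powr (2 * \<delta>) \<le> (\<Sum>j<h. X j (t div h))"
    proof
      fix t
      have "ms t / \<alpha> t powr (2 * \<delta>) = X (t mod h) (t div h)" by (simp add: X_def)
      also have "\<dots> \<le> (\<Sum>j<h. X j (t div h))"
        using h ms_nonneg by (intro member_le_sum) (auto simp: X_def)
      finally show "ms t / \<alpha> t powr (2 * \<delta>) \<le> (\<Sum>j<h. X j (t div h))" .
    qed
    have "(\<lambda>k. \<Sum>j<h. X j k) \<longlonglongrightarrow> (\<Sum>j<h. 0)" by (intro tendsto_sum Xlim) auto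
    then show "(\<lambda>t. \<Sum>j<h. X j (t div h)) \<longlonglongrightarrow> 0"
      using filterlim_compose[OF _ filterlim_div_nat_at_top[OF h]] by fastforce
  qed simp
qed

section \<open>Independence and conditioning\<close>

lemma generators_rv_sigma: "(\<Union>X\<in>Xs. {X -` B \<inter> space P | B. B \<in> sets borel}) \<subseteq> Pow (space P)"
  by auto

lemma space_rv_sigma [simp]: "space (rv_sigma P Xs) = space P"
  and sets_rv_sigma: "sets (rv_sigma P Xs) = sigma_sets (space P) (\<Union>X\<in>Xs. {X -` B \<inter> space P | B. B \<in> sets borel})"
  unfolding rv_sigma_def by (simp_all add: space_measure_of sets_measure_of generators_rv_sigma)

lemma measurable_rv_sigma: "X \<in> Xs \<Longrightarrow> X \<in> borel_measurable (rv_sigma P Xs)"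
  unfolding measurable_def by (auto simp: sets_rv_sigma)

lemma sets_rv_sigma_subset:
  assumes "space F = space P" "\<And>X. X \<in> Xs \<Longrightarrow> X \<in> borel_measurable F"
  shows "sets (rv_sigma P Xs) \<subseteq> sets F"
proof -
  have "X -` B \<inter> space P \<in> sets F" if "X \<in> Xs" "B \<in> sets borel" for X B
    using measurable_sets[OF assms(2)[OF that(1)] that(2)] assms(1) by simp
  then show ?thesis
    unfolding sets_rv_sigma assms(1)[symmetric] by (intro sets.sigma_sets_subset) auto
qed

lemma subalgebra_rv_sigma:
  "(\<And>X. X \<in> Xs \<Longrightarrow> X \<in> borel_measurable P) \<Longrightarrow> subalgebra P (rv_sigma P Xs)"
  by (simp add: subalgebra_def sets_rv_sigma_subset)

lemma sets_rv_sigma_mono: "Xs \<subseteq> Ys \<Longrightarrow> sets (rv_sigma P Xs) \<subseteq> sets (rv_sigma P Ys)"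
  by (intro sets_rv_sigma_subset) (auto intro: measurable_rv_sigma)

lemma sets_rv_sigma_Un:
  "sets (rv_sigma P (Xs \<union> Ys)) \<subseteq> sigma_sets (space P) (sets (rv_sigma P Xs) \<union> sets (rv_sigma P Ys))"
  unfolding sets_rv_sigma by (intro sigma_sets_mono) (auto intro!: sigma_sets.Basic)

lemma (in prob_space) subalgebra_rv_sigma_sigma_finite:
  assumes "\<And>X. X \<in> Xs \<Longrightarrow> X \<in> borel_measurable M"
  shows "sigma_finite_subalgebra M (rv_sigma M Xs)"
  by (intro finite_measure_subalgebra_is_sigma_finite finite_measure_subalgebra.intro
      finite_measure_subalgebra_axioms.intro subalgebra_rv_sigma assms finite_measure_axioms)

text \<open>Enlarges a conditioning sigma-algebra \<open>B0\<close> by independent information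
  \<open>A\<close>. For \<open>a\<close> in \<open>A\<close> and \<open>b\<close> in
  \<open>B0\<close>, independence factors the integral of \<open>X\<close> over their intersection
  into the probability of \<open>a\<close> times the integral over \<open>b\<close>, which is 0.
  Such intersections form an intersection-stable generator, and the property passes to complements
  and disjoint unions.\<close>

lemma (in prob_space) set_integral_zero_independent_join:
  fixes X :: "'a \<Rightarrow> real"
  assumes sp: "space A = space M" "space B = space M" "space B0 = space M"
    and indep: "indep_set (sets A) (sets B)" and B0: "sets B0 \<subseteq> sets B"
    and X: "integrable M X" "X \<in> borel_measurable B"
    and zero: "\<And>C. C \<in> sets B0 \<Longrightarrow> (LINT \<omega>:C|M. X \<omega>) = 0"
    and C: "C \<in> sigma_sets (space M) (sets A \<union> sets B0)"
  shows "(LINT \<omega>:C|M. X \<omega>) = 0"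
proof -
  define E where "E = {a \<inter> b | a b. a \<in> sets A \<and> b \<in> sets B0}"
  note evA = indep_setD_ev1[OF indep] and evB = indep_setD_ev2[OF indep]
  have top: "space M \<in> sets A" "space M \<in> sets B0" using sets.top[of A] sets.top[of B0] sp by auto
  have "Int_stable E"
  proof (rule Int_stableI)
    fix c d assume "c \<in> E" "d \<in> E"
    then obtain a b a' b' where "c = a \<inter> b" "d = a' \<inter> b'" "a \<in> sets A" "a' \<in> sets A" "b \<in> sets B0" "b' \<in> sets B0"
      unfolding E_def by auto
    then have "c \<inter> d = (a \<inter> a') \<inter> (b \<inter> b')" "a \<inter> a' \<in> sets A" "b \<inter> b' \<in> sets B0" by auto
    then show "c \<inter> d \<in> E" unfolding E_def by blast
  qed
  moreover have EM: "E \<subseteq> events" unfolding E_def using evA evB B0 by auto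
  then have "E \<subseteq> Pow (space M)" using sets.sets_into_space by auto
  moreover have "sets A \<union> sets B0 \<subseteq> E"
  proof
    fix c assume "c \<in> sets A \<union> sets B0"
    then have "c = c \<inter> space M \<and> c = space M \<inter> c"
      using sets.sets_into_space sp by blast
    with \<open>c \<in> sets A \<union> sets B0\<close> show "c \<in> E" unfolding E_def using top by blast
  qed
  then have "C \<in> sigma_sets (space M) E" using C sigma_sets_mono' by blast
  ultimately show ?thesis
  proof (induction rule: sigma_sets_induct_disjoint)
    case (basic c)
    then obtain a b where ab: "c = a \<inter> b" "a \<in> sets A" "b \<in> sets B0" unfolding E_def by auto
    then have [measurable]: "a \<in> events" "b \<in> events" "b \<in> sets B" using evA evB B0 by auto
    \<comment> \<open>The indicator of \<open>b\<close> is absorbed into \<open>?Y\<close>, which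
      stays measurable with respect to \<open>B\<close> and hence independent of the indicator of
      \<open>a\<close>.\<close>
    let ?Y = "\<lambda>\<omega>. indicat_real b \<omega> * X \<omega>"
    have Y: "?Y \<in> borel_measurable B" using X(2) by measurable
    have Yint: "integrable M ?Y" using integrable_mult_indicator[OF \<open>b \<in> events\<close> X(1)] by simp
    have "indep_var borel (indicat_real a) borel ?Y"
      unfolding indep_var_eq
    proof (intro conjI)
      show "random_variable borel ?Y" using Yint by auto
      show "indep_set (sigma_sets (space M) {indicat_real a -` S \<inter> space M | S. S \<in> sets borel})
         (sigma_sets (space M) {?Y -` S \<inter> space M | S. S \<in> sets borel})"
      proof (rule indep_setI)
        have 1: "sigma_sets (space M) {indicat_real a -` S \<inter> space M | S. S \<in> sets borel} \<subseteq> sets A"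
        proof -
          have "indicat_real a \<in> borel_measurable A" using ab by measurable
          then have "indicat_real a -` S \<inter> space M \<in> sets A" if "S \<in> sets borel" for S
            using measurable_sets[OF _ that] sp by metis
          then show ?thesis unfolding sp(1)[symmetric] by (intro sets.sigma_sets_subset) auto
        qed
        have 2: "sigma_sets (space M) {?Y -` S \<inter> space M | S. S \<in> sets borel} \<subseteq> sets B"
        proof -
          have "?Y -` S \<inter> space M \<in> sets B" if "S \<in> sets borel" for S
            using measurable_sets[OF Y that] sp by metis
          then show ?thesis unfolding sp(2)[symmetric] by (intro sets.sigma_sets_subset) auto
        qed
        show "sigma_sets (space M) {indicat_real a -` S \<inter> space M | S. S \<in> sets borel} \<subseteq> events"
          "sigma_sets (space M) {?Y -` S \<inter> space M | S. S \<in> sets borel} \<subseteq> events"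
          using 1 2 evA evB by blast+
        fix s t assume "s \<in> sigma_sets (space M) {indicat_real a -` S \<inter> space M | S. S \<in> sets borel}"
          "t \<in> sigma_sets (space M) {?Y -` S \<inter> space M | S. S \<in> sets borel}"
        then show "prob (s \<inter> t) = prob s * prob t" using 1 2 by (intro indep_setD[OF indep]) auto
      qed
    qed auto
    then have "(\<integral>\<omega>. indicat_real a \<omega> * ?Y \<omega> \<partial>M) = (\<integral>\<omega>. indicat_real a \<omega> \<partial>M) * (\<integral>\<omega>. ?Y \<omega> \<partial>M)"
    proof (intro indep_var_lebesgue_integral Yint)
      show "integrable M (indicat_real a)"
        using \<open>a \<in> events\<close> by (intro integrable_real_indicator) (auto simp: less_top[symmetric])
    qed
    also have "(\<integral>\<omega>. ?Y \<omega> \<partial>M) = 0" using zero[OF ab(3)] by (simp add: set_lebesgue_integral_def)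
    finally show ?case
      by (simp add: set_lebesgue_integral_def ab(1) indicator_inter_arith mult.assoc)
  next
    case empty
    show ?case by (simp add: set_lebesgue_integral_def)
  next
    case (compl c)
    then have cM: "c \<in> events" using EM sets.sigma_sets_subset by blast
    have "(LINT \<omega>:space M|M. X \<omega>) = 0" using zero top by blast
    moreover have "(LINT \<omega>:space M|M. X \<omega>) = (LINT \<omega>:space M - c|M. X \<omega>) + (LINT \<omega>:c|M. X \<omega>)"
    proof -
      have si: "set_integrable M s X" if "s \<in> events" for s
        unfolding set_integrable_def using integrable_mult_indicator[OF that X(1)] by simp
      have "space M = (space M - c) \<union> c" using sets.sets_into_space[OF cM] by auto
      then have "(LINT \<omega>:space M|M. X \<omega>) = (LINT \<omega>:(space M - c) \<union> c|M. X \<omega>)" by simp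
      also have "\<dots> = (LINT \<omega>:space M - c|M. X \<omega>) + (LINT \<omega>:c|M. X \<omega>)"
        by (rule set_integral_Un) (use cM si in auto)
      finally show ?thesis .
    qed
    ultimately show ?case using compl by simp
  next
    case (union S)
    have SM: "S i \<in> events" for i using union EM sets.sigma_sets_subset[of E M] by (auto simp: range_subsetD)
    have "(LINT \<omega>:(\<Union>i. S i)|M. X \<omega>) = (\<Sum>i. (LINT \<omega>:(S i)|M. X \<omega>))"
    proof (rule lebesgue_integral_countable_add[OF SM])
      show "S i \<inter> S j = {}" if "i \<noteq> j" for i j using union(1) that by (auto simp: disjoint_family_on_def)
      show "set_integrable M (\<Union>i. S i) X"
        unfolding set_integrable_def using SM by (intro integrable_mult_indicator X) auto
    qed
    then show ?case using union by simp
  qed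
qed

section \<open>Stacked coordinates\<close>

lemma abs_le_vnorm: "k < n \<Longrightarrow> \<bar>x k\<bar> \<le> vnorm n x"
  unfolding vnorm_def by (rule real_le_rsqrt) (auto intro!: member_le_sum)

text \<open>Testing with a coordinate vector isolates a column. Comparison with the supremum
  requires the set to be bounded above, which the row sums of absolute values provide.\<close>

lemma abs_entry_le_mat_norm:
  assumes "p < nr" "q < nc"
  shows "\<bar>A p q\<bar> \<le> mat_norm nr nc A"
proof -
  let ?S = "{vnorm nr (\<lambda>p. \<Sum>q<nc. A p q * x q) | x. vnorm nc x \<le> 1}"
  let ?e = "\<lambda>l. if l = q then 1 else (0::real)"
  have "vnorm nr (\<lambda>p. \<Sum>q<nc. A p q * x q) \<le> sqrt (\<Sum>p<nr. (\<Sum>q<nc. \<bar>A p q\<bar>)\<^sup>2)"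
    if "vnorm nc x \<le> 1" for x
  proof -
    have "\<bar>\<Sum>q<nc. A p q * x q\<bar> \<le> (\<Sum>q<nc. \<bar>A p q\<bar>)" for p
    proof -
      have "\<bar>\<Sum>q<nc. A p q * x q\<bar> \<le> (\<Sum>q<nc. \<bar>A p q\<bar> * \<bar>x q\<bar>)"
        using sum_abs[of "\<lambda>q. A p q * x q" "{..<nc}"] by (simp add: abs_mult)
      also have "\<dots> \<le> (\<Sum>q<nc. \<bar>A p q\<bar> * 1)"
        using abs_le_vnorm that by (intro sum_mono mult_left_mono) (auto intro: order_trans)
      finally show ?thesis by simp
    qed
    then show ?thesis unfolding vnorm_def[of nr]
      by (intro real_sqrt_le_mono sum_mono) (metis abs_ge_zero power2_abs power_mono)
  qed
  then have bdd: "bdd_above ?S" by (intro bdd_aboveI) blast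
  have "vnorm nc ?e = 1" using assms
    by (simp add: vnorm_def if_distrib[where f = "\<lambda>z. z\<^sup>2"] cong: if_cong)
  then have "vnorm nr (\<lambda>p. \<Sum>l<nc. A p l * ?e l) \<in> ?S" by auto
  then have "vnorm nr (\<lambda>p. \<Sum>l<nc. A p l * ?e l) \<le> mat_norm nr nc A"
    unfolding mat_norm_def using bdd by (intro cSup_upper)
  moreover have "(\<Sum>l<nc. A p l * ?e l) = A p q"
    using assms by (simp add: if_distrib[where f = "\<lambda>z. _ * z"] cong: if_cong)
  ultimately show ?thesis using abs_le_vnorm[of p nr "\<lambda>p. \<Sum>l<nc. A p l * ?e l"] assms by simp
qed

lemma offs_Suc: "offs m (Suc i) = offs m i + m i" by (simp add: offs_def)

lemma offs_mono: "i \<le> j \<Longrightarrow> offs m i \<le> offs m j"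
  unfolding offs_def by (intro sum_mono2) auto

lemma DH_entry:
  assumes "i < N" "k < M" "r < m i"
  shows "DH N M m Ht (i * M + k) (offs m i + r) = Ht i r k"
proof -
  have "i * M + k < N * M" using assms
    by (metis add.commute add_less_cancel_left less_le_trans mult_Suc mult_le_mono1 Suc_leI)
  then show ?thesis using assms by (simp add: DH_def)
qed

lemma abs_entry_le_DH_norm:
  assumes "i < N" "k < M" "r < m i"
  shows "\<bar>Ht i r k\<bar> \<le> mat_norm (N * M) (offs m N) (DH N M m Ht)"
proof -
  have 1: "i * M + k < N * M" using assms
    by (metis add.commute add_less_cancel_left less_le_trans mult_Suc mult_le_mono1 Suc_leI)
  have "offs m i + r < offs m (Suc i)" using assms by (simp add: offs_Suc)
  also have "\<dots> \<le> offs m N" using assms by (intro offs_mono) auto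
  finally show ?thesis using abs_entry_le_mat_norm[OF 1, of "offs m i + r" "offs m N" "DH N M m Ht"]
    by (simp add: DH_entry[where m = m, OF assms])
qed

lemma sum_offs_block:
  fixes g :: "nat \<Rightarrow> real"
  assumes i: "i < N"
  shows "(\<Sum>q<offs m N. if offs m i \<le> q \<and> q < offs m i + m i then g (q - offs m i) else 0) = (\<Sum>r<m i. g r)"
proof -
  have "offs m i + m i \<le> offs m N" using offs_mono[of "Suc i" N m] i by (simp add: offs_Suc)
  then have "{..<offs m N} \<inter> {q. offs m i \<le> q \<and> q < offs m i + m i} = {offs m i..<offs m i + m i}" by auto
  then have "(\<Sum>q<offs m N. if offs m i \<le> q \<and> q < offs m i + m i then g (q - offs m i) else 0)
      = (\<Sum>q\<in>{offs m i..<offs m i + m i}. g (q - offs m i))"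
    by (simp add: sum.If_cases)
  also have "\<dots> = (\<Sum>r<m i. g r)"
    by (simp add: sum.atLeastLessThan_shift_0[of _ "offs m i"] lessThan_atLeast0)
  finally show ?thesis .
qed

lemma offs_disjoint:
  assumes "offs m i \<le> q" "q < offs m i + m i" "offs m j \<le> q" "q < offs m j + m j"
  shows "i = j"
proof (rule ccontr)
  assume "i \<noteq> j"
  then consider "Suc i \<le> j" | "Suc j \<le> i" by linarith
  then show False
    using offs_mono[of "Suc i" j m] offs_mono[of "Suc j" i m] assms by cases (auto simp: offs_Suc)
qed

text \<open>The block-diagonal matrix with blocks \<open>H_i^T H_i\<close>; \<open>DH_gram\<close>
  identifies it with the product of \<open>DH\<close> and its transpose.\<close>

definition obs_gram :: "nat \<Rightarrow> (nat \<Rightarrow> nat) \<Rightarrow> (nat \<Rightarrow> nat \<Rightarrow> nat \<Rightarrow> real) \<Rightarrow> nat \<Rightarrow> nat \<Rightarrow> real" where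
  "obs_gram M m Ht p q = (if p div M = q div M
     then (\<Sum>r<m (p div M). Ht (p div M) r (p mod M) * Ht (p div M) r (q mod M)) else 0)"

lemma div_less_of_less_mult: "p < N * (M::nat) \<Longrightarrow> p div M < N"
  by (simp add: less_mult_imp_div_less)

lemma DH_gram:
  assumes p: "p < N * M" "p' < N * M"
  shows "(\<Sum>q<offs m N. DH N M m Ht p q * DH N M m Ht p' q) = obs_gram M m Ht p p'"
proof (cases "p div M = p' div M")
  case True
  have "(\<Sum>q<offs m N. DH N M m Ht p q * DH N M m Ht p' q)
     = (\<Sum>q<offs m N. if offs m (p div M) \<le> q \<and> q < offs m (p div M) + m (p div M)
         then (\<lambda>r. Ht (p div M) r (p mod M) * Ht (p div M) r (p' mod M)) (q - offs m (p div M)) else 0)"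
    using p True by (intro sum.cong) (auto simp: DH_def)
  also have "\<dots> = obs_gram M m Ht p p'"
    using sum_offs_block[OF div_less_of_less_mult[OF p(1)], of m "\<lambda>r. Ht (p div M) r (p mod M) * Ht (p div M) r (p' mod M)"] True
    by (simp add: obs_gram_def)
  finally show ?thesis .
next
  case False
  have "DH N M m Ht p q * DH N M m Ht p' q = 0" for q
    using offs_disjoint[of m "p div M" q "p' div M"] False by (auto simp: DH_def)
  then show ?thesis using False by (simp only: obs_gram_def) simp
qed

text \<open>\<open>Qmat\<close> before symmetrisation: the algorithm acts on the error through
  \<open>lap\<close>, while condition (ii.c) speaks of \<open>lapbar\<close>.\<close>

definition feedback :: "nat \<Rightarrow> nat \<Rightarrow> (nat \<Rightarrow> nat) \<Rightarrow> (nat \<Rightarrow> nat \<Rightarrow> real) \<Rightarrow> (nat \<Rightarrow> nat \<Rightarrow> nat \<Rightarrow> real)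
    \<Rightarrow> nat \<Rightarrow> nat \<Rightarrow> real" where
  "feedback N M m a Ht p q = lap N a (p div M) (q div M) * (if p mod M = q mod M then 1 else 0) + obs_gram M m Ht p q"

lemma obs_gram_sym: "obs_gram M m Ht p q = obs_gram M m Ht q p"
  by (auto simp: obs_gram_def mult.commute)

lemma Qmat_sym: "Qmat N M m a Ht p q = Qmat N M m a Ht q p"
  by (auto simp: Qmat_def lapbar_def mult.commute add.commute)

text \<open>A quadratic form sees only the symmetric part of its matrix, and \<open>2 * Qmat\<close>
  is \<open>feedback\<close> plus its transpose.\<close>

lemma quadratic_form_feedback:
  "(\<Sum>p<N * M. \<Sum>q<N * M. feedback N M m a Ht p q * x p * x q)
    = (\<Sum>p<N * M. \<Sum>q<N * M. Qmat N M m a Ht p q * (x p * x q))"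
proof -
  have Q: "2 * Qmat N M m a Ht p q = feedback N M m a Ht p q + feedback N M m a Ht q p"
    if "p < N * M" "q < N * M" for p q
    using DH_gram[OF that] obs_gram_sym[of M m Ht p q]
    by (auto simp: Qmat_def feedback_def lapbar_def algebra_simps)
  have "2 * (\<Sum>p<N * M. \<Sum>q<N * M. Qmat N M m a Ht p q * (x p * x q))
      = (\<Sum>p<N * M. \<Sum>q<N * M. (2 * Qmat N M m a Ht p q) * (x p * x q))"
    by (simp add: sum_distrib_left mult.assoc)
  also have "\<dots> = (\<Sum>p<N * M. \<Sum>q<N * M. feedback N M m a Ht p q * x p * x q + feedback N M m a Ht q p * x q * x p)"
    by (intro sum.cong refl) (auto simp: Q algebra_simps)
  also have "\<dots> = (\<Sum>p<N * M. \<Sum>q<N * M. feedback N M m a Ht p q * x p * x q)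
      + (\<Sum>p<N * M. \<Sum>q<N * M. feedback N M m a Ht q p * x q * x p)"
    by (simp add: sum.distrib)
  also have "(\<Sum>p<N * M. \<Sum>q<N * M. feedback N M m a Ht q p * x q * x p)
      = (\<Sum>p<N * M. \<Sum>q<N * M. feedback N M m a Ht p q * x p * x q)"
    by (rule sum.swap)
  finally show ?thesis by simp
qed

text \<open>The rows of \<open>lap\<close> sum to 0, so \<open>\<theta>\<close> cancels in the
  consensus part and survives only in the observation part.\<close>

lemma feedback_action:
  assumes M: "M > 0" and p: "p < N * M"
  shows "(\<Sum>q<N * M. feedback N M m a Ht p q * (x (q div M) (q mod M) - \<theta> (q mod M)))
    = (\<Sum>j<N. a (p div M) j * (x (p div M) (p mod M) - x j (p mod M)))
      + (\<Sum>r<m (p div M). Ht (p div M) r (p mod M) * (\<Sum>c<M. Ht (p div M) r c * (x (p div M) c - \<theta> c)))"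
proof -
  define i k where "i = p div M" and "k = p mod M"
  have ik: "i < N" "k < M" using p M by (auto simp: i_def k_def div_less_of_less_mult)
  let ?y = "\<lambda>j c. x j c - \<theta> c"
  have "(\<Sum>q<N * M. feedback N M m a Ht p q * (x (q div M) (q mod M) - \<theta> (q mod M)))
     = (\<Sum>j<N. \<Sum>c<M. (lap N a i j * (if k = c then 1 else 0)
        + (if i = j then \<Sum>r<m i. Ht i r k * Ht i r c else 0)) * ?y j c)"
    unfolding sum_product_index feedback_def obs_gram_def i_def k_def using M by (intro sum.cong refl) auto
  also have "\<dots> = (\<Sum>j<N. lap N a i j * ?y j k)
      + (\<Sum>j<N. if i = j then (\<Sum>c<M. (\<Sum>r<m i. Ht i r k * Ht i r c) * ?y j c) else 0)"
  proof -
    have "(\<Sum>c<M. (lap N a i j * (if k = c then 1 else 0)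
        + (if i = j then \<Sum>r<m i. Ht i r k * Ht i r c else 0)) * ?y j c)
      = lap N a i j * ?y j k + (if i = j then (\<Sum>c<M. (\<Sum>r<m i. Ht i r k * Ht i r c) * ?y j c) else 0)" for j
    proof -
      have "(\<Sum>c<M. (lap N a i j * (if k = c then 1 else 0)) * ?y j c)
          = (\<Sum>c<M. if k = c then lap N a i j * ?y j c else 0)" by (intro sum.cong) auto
      also have "\<dots> = lap N a i j * ?y j k" using ik by simp
      finally show ?thesis by (simp add: distrib_right sum.distrib)
    qed
    then show ?thesis by (simp add: sum.distrib)
  qed
  also have "(\<Sum>j<N. if i = j then (\<Sum>c<M. (\<Sum>r<m i. Ht i r k * Ht i r c) * ?y j c) else 0)
      = (\<Sum>c<M. (\<Sum>r<m i. Ht i r k * Ht i r c) * ?y i c)" using ik by simp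
  also have "\<dots> = (\<Sum>r<m i. Ht i r k * (\<Sum>c<M. Ht i r c * ?y i c))"
    unfolding sum_distrib_right sum_distrib_left by (subst sum.swap) (simp add: mult.assoc)
  also have "(\<Sum>j<N. lap N a i j * ?y j k) = (\<Sum>j<N. a i j * (x i k - x j k))"
  proof -
    have "(\<Sum>j<N. lap N a i j * ?y j k) = (\<Sum>j<N. if i = j then (\<Sum>l<N. a i l) * ?y j k else 0) - (\<Sum>j<N. a i j * ?y j k)"
      unfolding sum_subtractf[symmetric] lap_def by (intro sum.cong) (auto simp: algebra_simps)
    also have "(\<Sum>j<N. if i = j then (\<Sum>l<N. a i l) * ?y j k else 0) = (\<Sum>l<N. a i l) * ?y i k" using ik by simp
    also have "(\<Sum>l<N. a i l) * ?y i k - (\<Sum>j<N. a i j * ?y j k) = (\<Sum>j<N. a i j * (x i k - x j k))"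
      unfolding sum_distrib_right sum_subtractf[symmetric] by (intro sum.cong) (auto simp: algebra_simps)
    finally show ?thesis .
  qed
  finally show ?thesis by (simp add: i_def k_def)
qed

section \<open>The event-triggered algorithm\<close>

locale event_triggered_estimation = prob_space P for P :: "'w measure" +
  fixes N M :: nat and m :: "nat \<Rightarrow> nat" and a :: "nat \<Rightarrow> nat \<Rightarrow> real"
    and H :: "'w \<Rightarrow> nat \<Rightarrow> nat \<Rightarrow> nat \<Rightarrow> nat \<Rightarrow> real" and v :: "'w \<Rightarrow> nat \<Rightarrow> nat \<Rightarrow> nat \<Rightarrow> real"
    and \<theta> :: "nat \<Rightarrow> real" and x0 al f :: "nat \<Rightarrow> nat \<Rightarrow> real" and \<rho> cV D :: real
  assumes N: "N > 0" and M: "M > 0"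
    and a_nonneg: "\<And>i j. i < N \<Longrightarrow> j < N \<Longrightarrow> a i j \<ge> 0"
    and f_nonneg: "\<And>i t. i < N \<Longrightarrow> f i t \<ge> 0"
    and H_meas: "\<And>t i r c. (\<lambda>\<omega>. H \<omega> t i r c) \<in> borel_measurable P"
    and v_meas: "\<And>t i r. (\<lambda>\<omega>. v \<omega> t i r) \<in> borel_measurable P"
    and indep: "indep_set (sets (rv_sigma P (H_rvs N M m H (\<lambda>s. True))))
                          (sets (rv_sigma P (V_rvs N m v (\<lambda>s. True))))"
    and v_int: "\<And>t i r. i < N \<Longrightarrow> r < m i \<Longrightarrow> integrable P (\<lambda>\<omega>. v \<omega> t i r)"
    and v_mart: "\<And>t i r. i < N \<Longrightarrow> r < m i \<Longrightarrow>
      AE \<omega> in P. real_cond_exp P (filtr P N M m H v t) (\<lambda>\<omega>. v \<omega> t i r) \<omega> = 0"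
    and rho: "\<rho> > 2"
    and v_moment: "AE \<omega> in P. \<forall>t. nn_cond_exp P (filtr P N M m H v t)
                         (\<lambda>\<omega>. ennreal (V_norm N m (v \<omega> t) powr \<rho>)) \<omega> \<le> ennreal cV"
    and H_norm: "AE \<omega> in P. \<forall>t. (mat_norm (N * M) (offs m N) (DH N M m (H \<omega> t)))^2 \<le> D"
begin

abbreviation "\<F> t \<equiv> filtr P N M m H v t"

definition state :: "'w \<Rightarrow> nat \<Rightarrow> (nat \<Rightarrow> nat \<Rightarrow> real) \<times> (nat \<Rightarrow> nat \<Rightarrow> real)" where
  "state \<omega> t = est_state N M m a al f (H \<omega>) (\<lambda>s i r. (\<Sum>c<M. H \<omega> s i r c * \<theta> c) + v \<omega> s i r) x0 t"

definition err :: "nat \<Rightarrow> nat \<Rightarrow> 'w \<Rightarrow> real" where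
  "err t p \<omega> = fst (state \<omega> t) (p div M) (p mod M) - \<theta> (p mod M)"

text \<open>The event error: the effect of using the last sent estimates, the second component of
  the state, in place of the current ones.\<close>

definition gap :: "nat \<Rightarrow> nat \<Rightarrow> 'w \<Rightarrow> real" where
  "gap t p \<omega> = (\<Sum>j<N. a (p div M) j * (snd (state \<omega> t) j (p mod M) - fst (state \<omega> t) j (p mod M)))"

definition noise :: "nat \<Rightarrow> nat \<Rightarrow> 'w \<Rightarrow> real" where
  "noise t p \<omega> = (\<Sum>r<m (p div M). H \<omega> t (p div M) r (p mod M) * v \<omega> t (p div M) r)"

definition fb :: "nat \<Rightarrow> nat \<Rightarrow> nat \<Rightarrow> 'w \<Rightarrow> real" where
  "fb t p q \<omega> = feedback N M m a (H \<omega> t) p q"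

lemma pdiv: "p < N * M \<Longrightarrow> p div M < N" and pmod: "p mod M < M"
  using M by (auto simp: div_less_of_less_mult)

lemma state_0: "state \<omega> 0 = (x0, x0)" by (simp add: state_def)

lemma fst_state_Suc:
  "fst (state \<omega> (Suc t)) i k = fst (state \<omega> t) i k
     + al i t * (\<Sum>r<m i. H \<omega> t i r k * ((\<Sum>c<M. H \<omega> t i r c * \<theta> c) + v \<omega> t i r - (\<Sum>c<M. H \<omega> t i r c * fst (state \<omega> t) i c)))
     + al i t * (\<Sum>j\<in>{j. j < N \<and> a i j > 0}. a i j * (snd (state \<omega> t) j k - fst (state \<omega> t) i k))"
  by (simp add: state_def Let_def est_update_def)

lemma snd_state_Suc:
  "snd (state \<omega> (Suc t)) i = (if vnorm M (\<lambda>k. fst (state \<omega> (Suc t)) i k - snd (state \<omega> t) i k) > f i (Suc t)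
     then fst (state \<omega> (Suc t)) i else snd (state \<omega> t) i)"
  by (simp add: state_def Let_def)

lemma sum_parents:
  assumes "i < N" shows "(\<Sum>j\<in>{j. j < N \<and> a i j > 0}. a i j * g j) = (\<Sum>j<N. a i j * g j)"
  by (rule sum.mono_neutral_left) (use a_nonneg[OF assms] in \<open>auto simp: less_le\<close>)

text \<open>Writing the coupling \<open>xhat_j - x_i\<close> as
  \<open>(xhat_j - x_j) + (x_j - x_i)\<close> separates the event error from the Laplacian part; the
  measurement residual splits into noise and the observation part of
  \<open>feedback\<close>.\<close>

lemma err_Suc:
  assumes p: "p < N * M"
  shows "err (Suc t) p \<omega> = err t p \<omega> + al (p div M) t *
    (gap t p \<omega> + noise t p \<omega> - (\<Sum>q<N * M. fb t p q \<omega> * err t q \<omega>))"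
proof -
  define i k where "i = p div M" and "k = p mod M"
  have i: "i < N" using p pdiv by (simp add: i_def)
  let ?x = "fst (state \<omega> t)" and ?z = "snd (state \<omega> t)"
  have "(\<Sum>q<N * M. fb t p q \<omega> * err t q \<omega>)
      = (\<Sum>j<N. a i j * (?x i k - ?x j k)) + (\<Sum>r<m i. H \<omega> t i r k * (\<Sum>c<M. H \<omega> t i r c * (?x i c - \<theta> c)))"
    unfolding fb_def err_def i_def k_def by (rule feedback_action[OF M p])
  then have "gap t p \<omega> + noise t p \<omega> - (\<Sum>q<N * M. fb t p q \<omega> * err t q \<omega>)
     = (\<Sum>j<N. a i j * (?z j k - ?x j k)) + (\<Sum>r<m i. H \<omega> t i r k * v \<omega> t i r)
       - ((\<Sum>j<N. a i j * (?x i k - ?x j k)) + (\<Sum>r<m i. H \<omega> t i r k * (\<Sum>c<M. H \<omega> t i r c * (?x i c - \<theta> c))))"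
    by (simp add: gap_def noise_def i_def k_def)
  also have "\<dots> = (\<Sum>j<N. a i j * (?z j k - ?x i k))
      + (\<Sum>r<m i. H \<omega> t i r k * ((\<Sum>c<M. H \<omega> t i r c * \<theta> c) + v \<omega> t i r - (\<Sum>c<M. H \<omega> t i r c * ?x i c)))"
    by (simp add: algebra_simps sum_subtractf sum.distrib)
  finally show ?thesis
    unfolding err_def[of "Suc t"] fst_state_Suc sum_parents[OF i, folded i_def] sum_parents[OF pdiv[OF p]]
    by (simp add: err_def i_def k_def algebra_simps)
qed

text \<open>If sensor \<open>i\<close> has just sent, the difference is 0; otherwise the failed
  trigger test is the bound. At time 0 both components equal \<open>x0\<close>.\<close>

lemma sent_gap:
  assumes i: "i < N" and k: "k < M"
  shows "\<bar>snd (state \<omega> t) i k - fst (state \<omega> t) i k\<bar> \<le> f i t"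
proof (cases t)
  case 0
  then show ?thesis using f_nonneg[OF i] by (simp add: state_0)
next
  case (Suc s)
  let ?y = "\<lambda>k. fst (state \<omega> (Suc s)) i k - snd (state \<omega> s) i k"
  show ?thesis
  proof (cases "vnorm M ?y > f i (Suc s)")
    case True
    then show ?thesis using Suc f_nonneg[OF i] by (simp add: snd_state_Suc)
  next
    case False
    then have "\<bar>?y k\<bar> \<le> f i (Suc s)" using abs_le_vnorm[OF k, of ?y] by linarith
    then show ?thesis using Suc False by (simp add: snd_state_Suc abs_minus_commute)
  qed
qed

text \<open>Summing the weights over all rows makes the bound the same for every sensor while
  keeping it a fixed multiple of the largest threshold.\<close>

definition gap_bound :: "nat \<Rightarrow> real" where
  "gap_bound t = (\<Sum>i<N. \<Sum>j<N. a i j) * Max ((\<lambda>i. f i t) ` {..<N})"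

lemma gap_le: assumes p: "p < N * M" shows "\<bar>gap t p \<omega>\<bar> \<le> gap_bound t"
proof -
  let ?F = "Max ((\<lambda>i. f i t) ` {..<N})"
  have F: "f i t \<le> ?F" if "i < N" for i using that by (intro Max_ge) auto
  have F0: "?F \<ge> 0" using order_trans[OF f_nonneg[of 0 t] F[of 0]] N by simp
  have "\<bar>gap t p \<omega>\<bar> \<le> (\<Sum>j<N. \<bar>a (p div M) j * (snd (state \<omega> t) j (p mod M) - fst (state \<omega> t) j (p mod M))\<bar>)"
    unfolding gap_def by (rule sum_abs)
  also have "\<dots> \<le> (\<Sum>j<N. a (p div M) j * ?F)"
    unfolding abs_mult using a_nonneg[OF pdiv[OF p]]
    by (intro sum_mono mult_mono) (auto intro: order_trans[OF sent_gap[OF _ pmod] F])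
  also have "\<dots> = (\<Sum>j<N. a (p div M) j) * ?F" by (simp add: sum_distrib_right)
  also have "\<dots> \<le> gap_bound t"
    unfolding gap_bound_def using F0 pdiv[OF p] a_nonneg
    by (intro mult_right_mono member_le_sum[where f = "\<lambda>i. \<Sum>j<N. a i j"] sum_nonneg) auto
  finally show ?thesis .
qed

text \<open>\<open>F\<close> is left open because the result serves \<open>P\<close>,
  \<open>\<F> t\<close> and \<open>past t\<close> alike: the estimates at time \<open>t\<close> are
  built from data before \<open>t\<close> only.\<close>

lemma state_measurable:
  assumes "\<And>s i r c. s < t \<Longrightarrow> i < N \<Longrightarrow> r < m i \<Longrightarrow> c < M \<Longrightarrow> (\<lambda>\<omega>. H \<omega> s i r c) \<in> borel_measurable F"
    and "\<And>s i r. s < t \<Longrightarrow> i < N \<Longrightarrow> r < m i \<Longrightarrow> (\<lambda>\<omega>. v \<omega> s i r) \<in> borel_measurable F"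
    and "i < N" "k < M"
  shows "(\<lambda>\<omega>. fst (state \<omega> t) i k) \<in> borel_measurable F \<and> (\<lambda>\<omega>. snd (state \<omega> t) i k) \<in> borel_measurable F"
  using assms
proof (induction t arbitrary: i k)
  case 0
  show ?case by (simp add: state_0)
next
  case (Suc t)
  note IH = Suc.IH[OF Suc.prems(1) Suc.prems(2)]
  have x: "(\<lambda>\<omega>. fst (state \<omega> t) j c) \<in> borel_measurable F"
    and z: "(\<lambda>\<omega>. snd (state \<omega> t) j c) \<in> borel_measurable F" if "j < N" "c < M" for j c
    using IH that by auto
  \<comment> \<open>Needed for all coordinates of sensor \<open>i\<close>, since the trigger depends
    on the norm of the whole vector.\<close>
  have 1: "(\<lambda>\<omega>. fst (state \<omega> (Suc t)) i k) \<in> borel_measurable F" if "k < M" for k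
    unfolding fst_state_Suc
    by (intro borel_measurable_add borel_measurable_times borel_measurable_const borel_measurable_sum
        borel_measurable_diff) (use that Suc.prems x z in auto)
  have "(\<lambda>\<omega>. snd (state \<omega> (Suc t)) i k) = (\<lambda>\<omega>. if vnorm M (\<lambda>k. fst (state \<omega> (Suc t)) i k - snd (state \<omega> t) i k) > f i (Suc t)
     then fst (state \<omega> (Suc t)) i k else snd (state \<omega> t) i k)"
    by (simp add: snd_state_Suc fun_eq_iff)
  moreover have "\<dots> \<in> borel_measurable F"
  proof (rule measurable_If)
    have "(\<lambda>\<omega>. vnorm M (\<lambda>k. fst (state \<omega> (Suc t)) i k - snd (state \<omega> t) i k)) \<in> borel_measurable F"
      unfolding vnorm_def
      by (intro measurable_compose[OF _ borel_measurable_sqrt] borel_measurable_sum borel_measurable_power borel_measurable_diff)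
        (use 1 z Suc.prems in auto)
    then show "{\<omega> \<in> space F. vnorm M (\<lambda>k. fst (state \<omega> (Suc t)) i k - snd (state \<omega> t) i k) > f i (Suc t)} \<in> sets F"
      by measurable
  qed (use 1 z Suc.prems in auto)
  ultimately show ?case using 1 Suc.prems by simp
qed

lemma err_measurable:
  assumes "\<And>s i r c. s < t \<Longrightarrow> i < N \<Longrightarrow> r < m i \<Longrightarrow> c < M \<Longrightarrow> (\<lambda>\<omega>. H \<omega> s i r c) \<in> borel_measurable F"
    and "\<And>s i r. s < t \<Longrightarrow> i < N \<Longrightarrow> r < m i \<Longrightarrow> (\<lambda>\<omega>. v \<omega> s i r) \<in> borel_measurable F"
    and p: "p < N * M"
  shows "err t p \<in> borel_measurable F"
proof -
  have "(\<lambda>\<omega>. fst (state \<omega> t) (p div M) (p mod M)) \<in> borel_measurable F"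
    by (rule state_measurable[THEN conjunct1]) (use assms pdiv pmod in auto)
  then show ?thesis unfolding err_def by simp
qed

section \<open>Adaptedness, and conditioning on an enlarged past\<close>

lemma H_rvs_measurable: "X \<in> H_rvs N M m H S \<Longrightarrow> X \<in> borel_measurable P"
  and V_rvs_measurable: "X \<in> V_rvs N m v S \<Longrightarrow> X \<in> borel_measurable P"
  using H_meas v_meas by (auto simp: H_rvs_def V_rvs_def)

lemma filtration_subalgebra: "sigma_finite_subalgebra P (\<F> t)"
  unfolding filtr_def by (rule subalgebra_rv_sigma_sigma_finite) (auto intro: H_rvs_measurable V_rvs_measurable)

text \<open>The index of \<open>filtr\<close> is shifted: \<open>\<F> t\<close> is generated by the
  data before \<open>t\<close>, that is F(t-1), and these already determine the error at time
  \<open>t\<close>.\<close>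

lemma err_adapted: "p < N * M \<Longrightarrow> err t p \<in> borel_measurable (\<F> t)"
  by (rule err_measurable) (auto simp: filtr_def H_rvs_def V_rvs_def intro!: measurable_rv_sigma)

text \<open>Compared with \<open>\<F> t\<close>, the observation matrices of all times are added, in
  particular those of time \<open>t\<close> that multiply \<open>v\<close> in the noise
  term.\<close>

definition past :: "nat \<Rightarrow> 'w measure" where
  "past t = rv_sigma P (H_rvs N M m H (\<lambda>s. True) \<union> V_rvs N m v (\<lambda>s. s < t))"

lemma past_subalgebra: "sigma_finite_subalgebra P (past t)"
  unfolding past_def by (rule subalgebra_rv_sigma_sigma_finite) (auto intro: H_rvs_measurable V_rvs_measurable)

lemma err_past: "p < N * M \<Longrightarrow> err t p \<in> borel_measurable (past t)"
  by (rule err_measurable) (auto simp: past_def H_rvs_def V_rvs_def intro!: measurable_rv_sigma)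

lemma H_past: "i < N \<Longrightarrow> r < m i \<Longrightarrow> c < M \<Longrightarrow> (\<lambda>\<omega>. H \<omega> s i r c) \<in> borel_measurable (past t)"
  by (auto simp: past_def H_rvs_def intro!: measurable_rv_sigma)

text \<open>\<open>past t\<close> is generated by \<open>H\<close>, which is independent of the
  whole sequence \<open>v\<close>, and by \<open>v\<close> before \<open>t\<close>, on whose events
  the martingale property already gives integral 0. The join lemma combines the two, and these
  integrals determine the conditional expectation.\<close>

lemma noise_cond_exp_past:
  assumes ir: "i < N" "r < m i"
  shows "AE \<omega> in P. real_cond_exp P (past t) (\<lambda>\<omega>. v \<omega> t i r) \<omega> = 0"
proof -
  interpret Ft: sigma_finite_subalgebra P "\<F> t" by (rule filtration_subalgebra)
  interpret Gt: sigma_finite_subalgebra P "past t" by (rule past_subalgebra)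
  let ?A = "rv_sigma P (H_rvs N M m H (\<lambda>s. True))" and ?B = "rv_sigma P (V_rvs N m v (\<lambda>s. True))"
  let ?V0 = "rv_sigma P (V_rvs N m v (\<lambda>s. s < t))"
  have "(LINT \<omega>:C|P. v \<omega> t i r) = 0" if C: "C \<in> sets (past t)" for C
  proof (rule set_integral_zero_independent_join[where A = ?A and B = ?B and ?B0.0 = ?V0])
    show "sets ?V0 \<subseteq> sets ?B" by (rule sets_rv_sigma_mono) (auto simp: V_rvs_def)
    show "(\<lambda>\<omega>. v \<omega> t i r) \<in> borel_measurable ?B"
      using ir by (intro measurable_rv_sigma) (auto simp: V_rvs_def)
    show "C \<in> sigma_sets (space P) (sets ?A \<union> sets ?V0)"
      using C sets_rv_sigma_Un unfolding past_def by blast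
    fix C' assume "C' \<in> sets ?V0"
    then have "C' \<in> sets (\<F> t)" unfolding filtr_def using sets_rv_sigma_mono[of "V_rvs N m v (\<lambda>s. s < t)"] by blast
    then have "(LINT \<omega>:C'|P. v \<omega> t i r) = (LINT \<omega>:C'|P. real_cond_exp P (\<F> t) (\<lambda>\<omega>. v \<omega> t i r) \<omega>)"
      by (intro Ft.real_cond_exp_intA v_int ir)
    also have "\<dots> = (LINT \<omega>|P. 0)"
      unfolding set_lebesgue_integral_def
      by (rule integral_cong_AE) (use v_mart[OF ir, of t] Ft.subalg \<open>C' \<in> sets (\<F> t)\<close> in \<open>auto simp: subalgebra_def\<close>)
    finally show "(LINT \<omega>:C'|P. v \<omega> t i r) = 0" by simp
  qed (use indep v_int ir in auto)
  then show ?thesis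
    by (intro Gt.real_cond_exp_charact) (use v_int ir in \<open>auto simp: set_lebesgue_integral_def\<close>)
qed

section \<open>Almost sure bounds for the observation and feedback matrices\<close>

lemma H_bound: "AE \<omega> in P. \<forall>t. \<forall>i<N. \<forall>r<m i. \<forall>c<M. (H \<omega> t i r c)\<^sup>2 \<le> \<bar>D\<bar>"
  using H_norm
proof eventually_elim
  case (elim \<omega>)
  show ?case
  proof (intro allI impI)
    fix t i r c assume "i < N" "r < m i" "c < M"
    then have "\<bar>H \<omega> t i r c\<bar> \<le> mat_norm (N * M) (offs m N) (DH N M m (H \<omega> t))"
      by (intro abs_entry_le_DH_norm)
    then have "(H \<omega> t i r c)\<^sup>2 \<le> (mat_norm (N * M) (offs m N) (DH N M m (H \<omega> t)))\<^sup>2"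
      by (metis abs_ge_zero power2_abs power_mono)
    \<comment> \<open>The absolute value gives later estimates a nonnegative constant without an
      argument about the sign of \<open>D\<close>.\<close>
    then show "(H \<omega> t i r c)\<^sup>2 \<le> \<bar>D\<bar>" using elim by (smt (verit))
  qed
qed

lemma H_entry_bound:
  assumes "i < N" "r < m i" "c < M"
  shows "AE \<omega> in P. \<bar>H \<omega> t i r c\<bar> \<le> sqrt \<bar>D\<bar>"
  using H_bound by eventually_elim (use assms in \<open>auto intro: real_le_rsqrt\<close>)

definition "fb_bound = (\<Sum>i<N. \<Sum>j<N. \<bar>lap N a i j\<bar>) + (\<Sum>i<N. real (m i)) * \<bar>D\<bar>"

lemma fb_bound_nonneg: "fb_bound \<ge> 0"
  unfolding fb_bound_def by (intro add_nonneg_nonneg mult_nonneg_nonneg sum_nonneg) auto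

lemma fb_le:
  assumes p: "p < N * M" "q < N * M"
  shows "AE \<omega> in P. \<forall>t. \<bar>fb t p q \<omega>\<bar> \<le> fb_bound"
  using H_bound
proof eventually_elim
  case (elim \<omega>)
  show ?case
  proof
    fix t
    have "\<bar>lap N a (p div M) (q div M)\<bar> \<le> (\<Sum>j<N. \<bar>lap N a (p div M) j\<bar>)"
      using pdiv[OF p(2)] by (intro member_le_sum) auto
    also have "\<dots> \<le> (\<Sum>i<N. \<Sum>j<N. \<bar>lap N a i j\<bar>)"
      using pdiv[OF p(1)] by (intro member_le_sum[where f = "\<lambda>i. \<Sum>j<N. \<bar>lap N a i j\<bar>"]) (auto intro: sum_nonneg)
    finally have 1: "\<bar>lap N a (p div M) (q div M)\<bar> \<le> (\<Sum>i<N. \<Sum>j<N. \<bar>lap N a i j\<bar>)" .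
    have "\<bar>obs_gram M m (H \<omega> t) p q\<bar> \<le> real (m (p div M)) * \<bar>D\<bar>"
    proof (cases "p div M = q div M")
      case True
      have "\<bar>H \<omega> t (p div M) r (p mod M) * H \<omega> t (p div M) r (q mod M)\<bar> \<le> \<bar>D\<bar>" if "r < m (p div M)" for r
      proof -
        have "\<bar>H \<omega> t (p div M) r (p mod M)\<bar> \<le> sqrt \<bar>D\<bar>" "\<bar>H \<omega> t (p div M) r (q mod M)\<bar> \<le> sqrt \<bar>D\<bar>"
          using elim pdiv[OF p(1)] that pmod by (auto intro!: real_le_rsqrt)
        then have "\<bar>H \<omega> t (p div M) r (p mod M)\<bar> * \<bar>H \<omega> t (p div M) r (q mod M)\<bar> \<le> sqrt \<bar>D\<bar> * sqrt \<bar>D\<bar>"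
          by (intro mult_mono) auto
        then show ?thesis by (simp add: abs_mult)
      qed
      then have "(\<Sum>r<m (p div M). \<bar>H \<omega> t (p div M) r (p mod M) * H \<omega> t (p div M) r (q mod M)\<bar>) \<le> (\<Sum>r<m (p div M). \<bar>D\<bar>)"
        by (intro sum_mono) auto
      then show ?thesis using True by (simp add: obs_gram_def order_trans[OF sum_abs])
    qed (simp add: obs_gram_def)
    also have "\<dots> \<le> (\<Sum>i<N. real (m i)) * \<bar>D\<bar>"
      using pdiv[OF p(1)] by (intro mult_right_mono member_le_sum) auto
    finally show "\<bar>fb t p q \<omega>\<bar> \<le> fb_bound" using 1
      unfolding fb_def feedback_def fb_bound_def by auto
  qed
qed

lemma fb_measurable: "fb t p q \<in> borel_measurable P"
  unfolding fb_def feedback_def obs_gram_def using H_meas by (auto intro!: borel_measurable_add borel_measurable_sum borel_measurable_times)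

end

section \<open>Second moments of the noise and of the estimation error\<close>

context event_triggered_estimation begin

lemma V_norm_sq: "(V_norm N m y)\<^sup>2 = (\<Sum>i<N. \<Sum>r<m i. (y i r)\<^sup>2)"
  unfolding V_norm_def by (simp add: sum_nonneg)

lemma V_norm_nonneg: "V_norm N m y \<ge> 0"
  unfolding V_norm_def by (simp add: sum_nonneg)

lemma V_norm_measurable: "(\<lambda>\<omega>. V_norm N m (v \<omega> t)) \<in> borel_measurable P"
  unfolding V_norm_def
  by (intro measurable_compose[OF _ borel_measurable_sqrt] borel_measurable_sum borel_measurable_power v_meas)

lemma V_norm_moment: "(\<integral>\<^sup>+\<omega>. ennreal (V_norm N m (v \<omega> t) powr \<rho>) \<partial>P) \<le> ennreal cV"
proof -
  interpret Ft: sigma_finite_subalgebra P "\<F> t" by (rule filtration_subalgebra)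
  let ?g = "\<lambda>\<omega>. ennreal (V_norm N m (v \<omega> t) powr \<rho>)"
  note [measurable] = V_norm_measurable
  have "(\<integral>\<^sup>+\<omega>. ?g \<omega> \<partial>P) = (\<integral>\<^sup>+\<omega>. nn_cond_exp P (\<F> t) ?g \<omega> \<partial>P)"
    using Ft.nn_cond_exp_intg[of "\<lambda>_. 1" ?g] by simp
  also have "\<dots> \<le> (\<integral>\<^sup>+\<omega>. ennreal cV \<partial>P)"
    by (rule nn_integral_mono_AE) (use v_moment in auto)
  finally show ?thesis by (simp add: emeasure_space_1)
qed

text \<open>As \<open>\<rho> > 2\<close>, nonnegative \<open>y\<close> satisfy
  \<open>y\<^sup>2 \<le> 1 + y powr \<rho>\<close>, so the conditional moment bound controls second
  moments uniformly in time.\<close>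

lemma V_norm_sq_integrable: "integrable P (\<lambda>\<omega>. (V_norm N m (v \<omega> t))\<^sup>2)"
  and V_norm_sq_bound: "(\<integral>\<omega>. (V_norm N m (v \<omega> t))\<^sup>2 \<partial>P) \<le> 1 + \<bar>cV\<bar>"
proof -
  note [measurable] = V_norm_measurable
  have le: "y\<^sup>2 \<le> 1 + y powr \<rho>" if "y \<ge> 0" for y :: real
  proof (cases "y \<le> 1")
    case True
    then have "y\<^sup>2 \<le> 1" using that by (simp add: power_le_one)
    then show ?thesis using powr_ge_zero[of y \<rho>] by linarith
  next
    case False
    then have "y powr 2 \<le> y powr \<rho>" using rho by (intro powr_mono) auto
    then show ?thesis using False by (simp add: powr_numeral)
  qed
  have "(\<integral>\<^sup>+\<omega>. ennreal ((V_norm N m (v \<omega> t))\<^sup>2) \<partial>P) \<le> (\<integral>\<^sup>+\<omega>. 1 + ennreal (V_norm N m (v \<omega> t) powr \<rho>) \<partial>P)"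
    by (intro nn_integral_mono) (simp add: le V_norm_nonneg flip: ennreal_1 ennreal_plus)
  also have "\<dots> = 1 + (\<integral>\<^sup>+\<omega>. ennreal (V_norm N m (v \<omega> t) powr \<rho>) \<partial>P)"
    by (subst nn_integral_add) (auto simp: emeasure_space_1)
  also have "\<dots> \<le> 1 + ennreal \<bar>cV\<bar>"
    by (intro add_left_mono order_trans[OF V_norm_moment] ennreal_leI) auto
  also have "\<dots> = ennreal (1 + \<bar>cV\<bar>)" by (simp flip: ennreal_1)
  finally have *: "(\<integral>\<^sup>+\<omega>. ennreal ((V_norm N m (v \<omega> t))\<^sup>2) \<partial>P) \<le> ennreal (1 + \<bar>cV\<bar>)" .
  show i: "integrable P (\<lambda>\<omega>. (V_norm N m (v \<omega> t))\<^sup>2)"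
    by (rule integrableI_nonneg) (use * in \<open>auto intro: le_less_trans\<close>)
  have "ennreal (\<integral>\<omega>. (V_norm N m (v \<omega> t))\<^sup>2 \<partial>P) \<le> ennreal (1 + \<bar>cV\<bar>)"
    using nn_integral_eq_integral[OF i] * by simp
  then show "(\<integral>\<omega>. (V_norm N m (v \<omega> t))\<^sup>2 \<partial>P) \<le> 1 + \<bar>cV\<bar>"
    by (subst (asm) ennreal_le_iff) auto
qed

lemma v_sq_le: "i < N \<Longrightarrow> r < m i \<Longrightarrow> (y i r)\<^sup>2 \<le> (V_norm N m y)\<^sup>2"
  unfolding V_norm_sq
  by (rule order_trans[OF member_le_sum[where f = "\<lambda>r. (y i r)\<^sup>2" and A = "{..<m i}"]
        member_le_sum[where f = "\<lambda>i. \<Sum>r<m i. (y i r)\<^sup>2"]]) (auto intro: sum_nonneg)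

lemma v_square_integrable:
  assumes "i < N" "r < m i"
  shows "square_integrable P (\<lambda>\<omega>. v \<omega> t i r)"
  unfolding square_integrable_def
proof
  show "integrable P (\<lambda>\<omega>. (v \<omega> t i r)\<^sup>2)"
    by (rule Bochner_Integration.integrable_bound[OF V_norm_sq_integrable[of t]])
      (use v_meas v_sq_le[OF assms] in auto)
qed (rule v_meas)

lemma noise_square_integrable: "p < N * M \<Longrightarrow> square_integrable P (noise t p)"
  unfolding noise_def
  by (intro square_integrable_sum square_integrable_bounded_mult[OF v_square_integrable H_meas H_entry_bound])
    (auto simp: pdiv pmod)

definition "noise_bound = real (N * M) * (\<Sum>i<N. real (m i)) * \<bar>D\<bar> * (1 + \<bar>cV\<bar>)"

lemma noise_second_moment: "(\<integral>\<omega>. (\<Sum>p<N * M. (noise t p \<omega>)\<^sup>2) \<partial>P) \<le> noise_bound"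
proof -
  let ?c = "real (N * M) * (\<Sum>i<N. real (m i)) * \<bar>D\<bar>"
  have "(\<integral>\<omega>. (\<Sum>p<N * M. (noise t p \<omega>)\<^sup>2) \<partial>P) \<le> (\<integral>\<omega>. ?c * (V_norm N m (v \<omega> t))\<^sup>2 \<partial>P)"
  proof (rule integral_mono_AE)
    show "integrable P (\<lambda>\<omega>. \<Sum>p<N * M. (noise t p \<omega>)\<^sup>2)"
      by (auto intro!: Bochner_Integration.integrable_sum square_integrableD noise_square_integrable)
    show "integrable P (\<lambda>\<omega>. ?c * (V_norm N m (v \<omega> t))\<^sup>2)"
      by (intro integrable_mult_right V_norm_sq_integrable)
    show "AE \<omega> in P. (\<Sum>p<N * M. (noise t p \<omega>)\<^sup>2) \<le> ?c * (V_norm N m (v \<omega> t))\<^sup>2"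
      using H_bound
    proof eventually_elim
      case (elim \<omega>)
      have "(noise t p \<omega>)\<^sup>2 \<le> (\<Sum>i<N. real (m i)) * \<bar>D\<bar> * (V_norm N m (v \<omega> t))\<^sup>2" if p: "p < N * M" for p
      proof -
        let ?i = "p div M"
        have "(noise t p \<omega>)\<^sup>2 \<le> (\<Sum>r<m ?i. (H \<omega> t ?i r (p mod M) * v \<omega> t ?i r)\<^sup>2) * card {..<m ?i}"
          unfolding noise_def by (rule sum_squared_le_sum_of_squares)
        also have "(\<Sum>r<m ?i. (H \<omega> t ?i r (p mod M) * v \<omega> t ?i r)\<^sup>2) \<le> (\<Sum>r<m ?i. \<bar>D\<bar> * (v \<omega> t ?i r)\<^sup>2)"
          unfolding power_mult_distrib using elim pdiv[OF p] pmod by (intro sum_mono mult_right_mono) auto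
        also have "\<dots> = \<bar>D\<bar> * (\<Sum>r<m ?i. (v \<omega> t ?i r)\<^sup>2)" by (simp add: sum_distrib_left)
        also have "\<dots> \<le> \<bar>D\<bar> * (V_norm N m (v \<omega> t))\<^sup>2"
          unfolding V_norm_sq using pdiv[OF p]
          by (intro mult_left_mono member_le_sum[where f = "\<lambda>i. \<Sum>r<m i. (v \<omega> t i r)\<^sup>2"]) (auto intro: sum_nonneg)
        finally have "(noise t p \<omega>)\<^sup>2 \<le> \<bar>D\<bar> * (V_norm N m (v \<omega> t))\<^sup>2 * real (m ?i)"
          by (simp add: mult_right_mono)
        also have "\<dots> \<le> \<bar>D\<bar> * (V_norm N m (v \<omega> t))\<^sup>2 * (\<Sum>i<N. real (m i))"
          using pdiv[OF p] by (intro mult_left_mono member_le_sum) auto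
        finally show ?thesis by (simp add: mult_ac)
      qed
      then have "(\<Sum>p<N * M. (noise t p \<omega>)\<^sup>2) \<le> (\<Sum>p<N * M. (\<Sum>i<N. real (m i)) * \<bar>D\<bar> * (V_norm N m (v \<omega> t))\<^sup>2)"
        by (intro sum_mono) auto
      then show ?case by (simp add: mult.assoc)
    qed
  qed
  also have "\<dots> = ?c * (\<integral>\<omega>. (V_norm N m (v \<omega> t))\<^sup>2 \<partial>P)" by simp
  also have "\<dots> \<le> noise_bound"
    unfolding noise_bound_def by (intro mult_left_mono V_norm_sq_bound mult_nonneg_nonneg sum_nonneg) auto
  finally show ?thesis .
qed

lemma gap_measurable: "p < N * M \<Longrightarrow> gap t p \<in> borel_measurable P"
proof -
  assume p: "p < N * M"
  have "(\<lambda>\<omega>. fst (state \<omega> t) j (p mod M)) \<in> borel_measurable P"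
       "(\<lambda>\<omega>. snd (state \<omega> t) j (p mod M)) \<in> borel_measurable P" if "j < N" for j
    using state_measurable[where F = P and t = t, OF H_meas v_meas that pmod[of p]] by auto
  then show "gap t p \<in> borel_measurable P" unfolding gap_def by (intro borel_measurable_sum) auto
qed

lemma fb_entry_bound: "p < N * M \<Longrightarrow> q < N * M \<Longrightarrow> AE \<omega> in P. \<bar>fb t p q \<omega>\<bar> \<le> fb_bound"
  by (rule eventually_mono[OF fb_le[of p q]]) auto

lemma err_square_integrable: "p < N * M \<Longrightarrow> square_integrable P (err t p)"
proof (induction t arbitrary: p)
  case 0
  then show ?case by (simp add: err_def[abs_def] state_0 square_integrable_def)
next
  case (Suc t)
  have "square_integrable P (gap t p)"
    using gap_le[OF Suc.prems] by (intro square_integrable_bounded[where K = "gap_bound t"] gap_measurable Suc.prems) auto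
  moreover have "square_integrable P (\<lambda>\<omega>. \<Sum>q<N * M. fb t p q \<omega> * err t q \<omega>)"
    by (intro square_integrable_sum square_integrable_bounded_mult[OF Suc.IH fb_measurable fb_entry_bound])
      (use Suc.prems in auto)
  ultimately show ?case
    unfolding err_Suc[OF Suc.prems, abs_def]
    by (intro square_integrable_add square_integrable_cmult square_integrable_diff Suc noise_square_integrable)
qed

text \<open>The noise at time \<open>t\<close> is centred even given all observation matrices, since these are
  independent of the noise sequence.\<close>

lemma err_noise_orthogonal:
  assumes p: "p < N * M"
  shows "(\<integral>\<omega>. err t p \<omega> * noise t p \<omega> \<partial>P) = 0"
proof -
  interpret Gt: sigma_finite_subalgebra P "past t" by (rule past_subalgebra)
  let ?i = "p div M" and ?k = "p mod M"
  have *: "integrable P (\<lambda>\<omega>. (H \<omega> t ?i r ?k * err t p \<omega>) * v \<omega> t ?i r) \<and>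
    (\<integral>\<omega>. (H \<omega> t ?i r ?k * err t p \<omega>) * v \<omega> t ?i r \<partial>P) = 0" if r: "r < m ?i" for r
  proof
    have i: "?i < N" using pdiv[OF p] .
    show int: "integrable P (\<lambda>\<omega>. (H \<omega> t ?i r ?k * err t p \<omega>) * v \<omega> t ?i r)"
      by (intro square_integrable_mult v_square_integrable i r
          square_integrable_bounded_mult[OF err_square_integrable[OF p] H_meas H_entry_bound] pmod)
    have "(\<lambda>\<omega>. H \<omega> t ?i r ?k * err t p \<omega>) \<in> borel_measurable (past t)"
      by (intro borel_measurable_times H_past err_past i r pmod p)
    from Gt.real_cond_exp_intg(2)[OF int this v_meas]
    have "(\<integral>\<omega>. (H \<omega> t ?i r ?k * err t p \<omega>) * v \<omega> t ?i r \<partial>P)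
        = (\<integral>\<omega>. (H \<omega> t ?i r ?k * err t p \<omega>) * real_cond_exp P (past t) (\<lambda>\<omega>. v \<omega> t ?i r) \<omega> \<partial>P)" by simp
    also have "\<dots> = (\<integral>\<omega>. 0 \<partial>P)"
    proof (rule integral_cong_AE)
      show "(\<lambda>\<omega>. (H \<omega> t ?i r ?k * err t p \<omega>) * real_cond_exp P (past t) (\<lambda>\<omega>. v \<omega> t ?i r) \<omega>) \<in> borel_measurable P"
        using square_integrableD(1)[OF err_square_integrable[OF p]] H_meas by auto
    qed (use noise_cond_exp_past[OF i r, of t] in auto)
    finally show "(\<integral>\<omega>. (H \<omega> t ?i r ?k * err t p \<omega>) * v \<omega> t ?i r \<partial>P) = 0" by simp
  qed
  have "err t p \<omega> * noise t p \<omega> = (\<Sum>r<m ?i. (H \<omega> t ?i r ?k * err t p \<omega>) * v \<omega> t ?i r)" for \<omega>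
    by (simp add: noise_def sum_distrib_left mult_ac)
  then show ?thesis using * by (simp add: Bochner_Integration.integral_sum)
qed

sublocale perturbed_recursion P "N * M" fb_bound noise_bound err gap noise fb "\<lambda>t p. al (p div M) t" gap_bound
proof unfold_locales
  show "fb_bound \<ge> 0" by (rule fb_bound_nonneg)
  show "(\<integral>\<omega>. (\<Sum>p<N * M. (noise t p \<omega>)\<^sup>2) \<partial>P) \<le> noise_bound" for t by (rule noise_second_moment)
qed (use err_square_integrable fb_measurable fb_entry_bound gap_le noise_square_integrable
    err_noise_orthogonal err_Suc in auto)

text \<open>The error at time \<open>s\<close> is measurable with respect to \<open>\<F> s\<close>,
  so inside the integral each matrix may be replaced by its conditional expectation. The eigenvalue
  bound is then applied, for almost every outcome, to the summed conditional matrices with the error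
  as test vector.\<close>

lemma gain_sum_ge:
  assumes low: "AE \<omega> in P. c \<le> lambda_min (N * M)
      (\<lambda>p p'. \<Sum>t\<in>{s..<s + h}. real_cond_exp P (\<F> s) (\<lambda>\<omega>. Qmat N M m a (H \<omega> t) p p') \<omega>)"
  shows "c * ms s \<le> (\<Sum>j<h. gain s (s + j))"
proof -
  interpret Fs: sigma_finite_subalgebra P "\<F> s" by (rule filtration_subalgebra)
  let ?Q = "\<lambda>t p q \<omega>. Qmat N M m a (H \<omega> t) p q"
  let ?R = "\<lambda>t p q. real_cond_exp P (\<F> s) (?Q t p q)"
  \<comment> \<open>As the average of \<open>fb\<close> and its transpose, \<open>Qmat\<close>
    inherits measurability and the integrability of its products with the errors.\<close>
  have Qfb: "?Q t p q \<omega> = (fb t p q \<omega> + fb t q p \<omega>) / 2" if "p < N * M" "q < N * M" for t p q \<omega>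
    using DH_gram[OF that] obs_gram_sym[of M m "H \<omega> t" p q]
    by (auto simp: Qmat_def fb_def feedback_def lapbar_def field_simps)
  have Qm: "?Q t p q \<in> borel_measurable P" if "p < N * M" "q < N * M" for t p q
    using fb_measurable by (simp add: Qfb[OF that])
  have int: "integrable P (\<lambda>\<omega>. (err s p \<omega> * err s q \<omega>) * ?Q t p q \<omega>)" if pq: "p < N * M" "q < N * M" for t p q
  proof -
    have "integrable P (\<lambda>\<omega>. ((fb t p q \<omega> * err s p \<omega>) * err s q \<omega> + (fb t q p \<omega> * err s p \<omega>) * err s q \<omega>) / 2)"
      by (intro integrable_divide Bochner_Integration.integrable_add square_integrable_mult err_square_integrable
          square_integrable_bounded_mult[OF err_square_integrable fb_measurable fb_entry_bound] pq)
    then show ?thesis by (simp add: Qfb[OF pq] algebra_simps)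
  qed
  have meas: "(\<lambda>\<omega>. err s p \<omega> * err s q \<omega>) \<in> borel_measurable (\<F> s)" if "p < N * M" "q < N * M" for p q
    by (intro borel_measurable_times err_adapted that)
  note ce = Fs.real_cond_exp_intg[OF int meas Qm]
  have g: "gain s t = (\<integral>\<omega>. (\<Sum>p<N * M. \<Sum>q<N * M. ?R t p q \<omega> * err s p \<omega> * err s q \<omega>) \<partial>P)" for t
  proof -
    have "gain s t = (\<integral>\<omega>. (\<Sum>p<N * M. \<Sum>q<N * M. (err s p \<omega> * err s q \<omega>) * ?Q t p q \<omega>) \<partial>P)"
      unfolding gain_def fb_def quadratic_form_feedback by (simp add: mult.commute)
    also have "\<dots> = (\<Sum>p<N * M. \<Sum>q<N * M. (\<integral>\<omega>. (err s p \<omega> * err s q \<omega>) * ?Q t p q \<omega> \<partial>P))"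
      using int by (subst Bochner_Integration.integral_sum) (auto intro!: sum.cong Bochner_Integration.integral_sum)
    also have "\<dots> = (\<Sum>p<N * M. \<Sum>q<N * M. (\<integral>\<omega>. (err s p \<omega> * err s q \<omega>) * ?R t p q \<omega> \<partial>P))"
      using ce(2) by (intro sum.cong refl) auto
    also have "\<dots> = (\<integral>\<omega>. (\<Sum>p<N * M. \<Sum>q<N * M. (err s p \<omega> * err s q \<omega>) * ?R t p q \<omega>) \<partial>P)"
      using ce(1) by (subst Bochner_Integration.integral_sum) (auto intro!: sum.cong Bochner_Integration.integral_sum[symmetric])
    finally show ?thesis by (simp add: mult_ac)
  qed
  have iR: "integrable P (\<lambda>\<omega>. \<Sum>p<N * M. \<Sum>q<N * M. ?R t p q \<omega> * err s p \<omega> * err s q \<omega>)" for t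
    using ce(1) by (intro Bochner_Integration.integrable_sum) (auto simp: mult_ac)
  have "(\<Sum>j<h. gain s (s + j)) = (\<Sum>t\<in>{s..<s + h}. gain s t)"
    by (simp add: sum.atLeastLessThan_shift_0[of _ s] lessThan_atLeast0)
  also have "\<dots> = (\<integral>\<omega>. (\<Sum>t\<in>{s..<s + h}. \<Sum>p<N * M. \<Sum>q<N * M. ?R t p q \<omega> * err s p \<omega> * err s q \<omega>) \<partial>P)"
    using iR by (simp add: g Bochner_Integration.integral_sum)
  finally have G: "(\<Sum>j<h. gain s (s + j)) = \<dots>" .
  have "c * ms s = (\<integral>\<omega>. c * (\<Sum>p<N * M. (err s p \<omega>)\<^sup>2) \<partial>P)" by (simp add: ms_def)
  also have "\<dots> \<le> (\<integral>\<omega>. (\<Sum>t\<in>{s..<s + h}. \<Sum>p<N * M. \<Sum>q<N * M. ?R t p q \<omega> * err s p \<omega> * err s q \<omega>) \<partial>P)"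
  proof (rule integral_mono_AE)
    show "AE \<omega> in P. c * (\<Sum>p<N * M. (err s p \<omega>)\<^sup>2)
        \<le> (\<Sum>t\<in>{s..<s + h}. \<Sum>p<N * M. \<Sum>q<N * M. ?R t p q \<omega> * err s p \<omega> * err s q \<omega>)"
      using low
    proof eventually_elim
      case (elim \<omega>)
      let ?S = "\<lambda>p q. \<Sum>t\<in>{s..<s + h}. ?R t p q \<omega>"
      have "c * (\<Sum>p<N * M. (err s p \<omega>)\<^sup>2) \<le> lambda_min (N * M) ?S * (\<Sum>p<N * M. (err s p \<omega>)\<^sup>2)"
        using elim by (intro mult_right_mono sum_nonneg) auto
      \<comment> \<open>\<open>?S\<close> is symmetric at every outcome, not just almost surely: by
        \<open>Qmat_sym\<close>, opposite entries are conditional expectations of the same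
        function.\<close>
      also have "\<dots> \<le> (\<Sum>p<N * M. \<Sum>q<N * M. ?S p q * err s p \<omega> * err s q \<omega>)"
        using N M by (intro lambda_min_le_quadratic_form) (simp_all add: Qmat_sym)
      also have "\<dots> = (\<Sum>t\<in>{s..<s + h}. \<Sum>p<N * M. \<Sum>q<N * M. ?R t p q \<omega> * err s p \<omega> * err s q \<omega>)"
        unfolding sum_distrib_right sum.swap[of _ "{..<N * M}" "{s..<s + h}"] ..
      finally show ?case .
    qed
  qed (use integrable_squares(1) iR in auto)
  finally show ?thesis using G by simp
qed

text \<open>The final statement uses a nonnegative integral, which is meaningful without
  integrability; since the errors are square integrable, it reduces to the real quantity
  \<open>ms t\<close>.\<close>

lemma nn_integral_error:
  "(\<integral>\<^sup>+\<omega>. ennreal (\<Sum>i<N. \<Sum>k<M. (est_x N M m a al f H v \<theta> x0 \<omega> t i k - \<theta> k)\<^sup>2) \<partial>P) = ennreal (ms t)"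
proof -
  have "(\<Sum>i<N. \<Sum>k<M. (est_x N M m a al f H v \<theta> x0 \<omega> t i k - \<theta> k)\<^sup>2) = (\<Sum>p<N * M. (err t p \<omega>)\<^sup>2)" for \<omega>
    unfolding sum_product_index using M by (simp add: err_def state_def est_x_def)
  then show ?thesis
    unfolding ms_def using integrable_squares(1)[of t]
    by (simp add: nn_integral_eq_integral sum_nonneg)
qed

end

theorem theorem1:
  fixes P :: "'w measure"
    and N M :: nat and m :: "nat \<Rightarrow> nat"
    and a :: "nat \<Rightarrow> nat \<Rightarrow> real"
    and H :: "'w \<Rightarrow> nat \<Rightarrow> nat \<Rightarrow> nat \<Rightarrow> nat \<Rightarrow> real"
    and v :: "'w \<Rightarrow> nat \<Rightarrow> nat \<Rightarrow> nat \<Rightarrow> real"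
    and \<theta> :: "nat \<Rightarrow> real" and x0 :: "nat \<Rightarrow> nat \<Rightarrow> real"
    and al f :: "nat \<Rightarrow> nat \<Rightarrow> real"
    and \<alpha> :: "nat \<Rightarrow> real" and \<alpha>0 \<delta> \<rho> cV D lam :: real and h :: nat
  assumes P: "prob_space P"
    and NM: "N > 0" "M > 0"
    and graph: "\<forall>i<N. \<forall>j<N. a i j \<ge> 0" "\<forall>i<N. a i i = 0"
    and steps: "\<forall>i<N. \<forall>t. al i t > 0"
    and thresh: "\<forall>i<N. \<forall>t. f i t \<ge> 0"
    and delta: "0 \<le> \<delta>" "\<delta> < 1/2"
    \<comment> \<open>(i.a)\<close>
    and ia: "\<forall>t. \<alpha> t > 0" "\<forall>i<N. (\<lambda>t. al i t / \<alpha> t) \<longlonglongrightarrow> 1" "\<alpha> \<longlonglongrightarrow> 0"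
      "\<not> summable \<alpha>" "(\<lambda>t. 1 / \<alpha> (Suc t) - 1 / \<alpha> t) \<longlonglongrightarrow> \<alpha>0" "\<alpha>0 \<ge> 0"
    \<comment> \<open>H and v are random variables\<close>
    and meas: "\<forall>t i r c. (\<lambda>\<omega>. H \<omega> t i r c) \<in> borel_measurable P"
      "\<forall>t i r. (\<lambda>\<omega>. v \<omega> t i r) \<in> borel_measurable P"
    \<comment> \<open>(ii.a)\<close>
    and iia: "prob_space.indep_set P (sets (rv_sigma P (H_rvs N M m H (\<lambda>s. True))))
                                     (sets (rv_sigma P (V_rvs N m v (\<lambda>s. True))))"
    \<comment> \<open>(ii.b)\<close>
    and iib: "\<forall>t i r. i < N \<and> r < m i \<longrightarrow> integrable P (\<lambda>\<omega>. v \<omega> t i r) \<and>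
                (AE \<omega> in P. real_cond_exp P (filtr P N M m H v t) (\<lambda>\<omega>. v \<omega> t i r) \<omega> = 0)"
      "\<rho> > 2"
      "AE \<omega> in P. \<forall>t. nn_cond_exp P (filtr P N M m H v t)
                         (\<lambda>\<omega>. ennreal (V_norm N m (v \<omega> t) powr \<rho>)) \<omega> \<le> ennreal cV"
    \<comment> \<open>(ii.c)\<close>
    and iic: "AE \<omega> in P. \<forall>t. (mat_norm (N * M) (offs m N) (DH N M m (H \<omega> t)))^2 \<le> D"
      "h > 0" "lam > 0"
      "\<forall>k. AE \<omega> in P. lambda_min (N * M)
              (\<lambda>p p'. \<Sum>t\<in>{k * h..<(Suc k) * h}.
                 real_cond_exp P (filtr P N M m H v (k * h)) (\<lambda>\<omega>. Qmat N M m a (H \<omega> t) p p') \<omega>)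
            \<ge> lam + real h * \<alpha>0 * \<delta>"
    \<comment> \<open>(iii.a)\<close>
    and iiia: "(\<lambda>t. Max ((\<lambda>i. f i t) ` {..<N}) / \<alpha> t powr \<delta>) \<longlonglongrightarrow> 0"
  shows "(\<lambda>t. (\<integral>\<^sup>+\<omega>. ennreal (\<Sum>i<N. \<Sum>k<M. (est_x N M m a al f H v \<theta> x0 \<omega> t i k - \<theta> k)^2) \<partial>P)
               / ennreal (\<alpha> t powr (2 * \<delta>))) \<longlonglongrightarrow> 0"
proof -
  interpret prob_space P by (rule P)
  interpret event_triggered_estimation P N M m a H v \<theta> x0 al f \<rho> cV D
    by unfold_locales (use NM graph thresh meas iia iib iic in auto)
  have "(\<lambda>t. ms t / \<alpha> t powr (2 * \<delta>)) \<longlonglongrightarrow> 0"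
  proof (rule scaled_mean_square_tendsto_zero[where h = h and lam = lam and ?\<alpha>0.0 = \<alpha>0])
    show "(\<lambda>t. al (p div M) t / \<alpha> t) \<longlonglongrightarrow> 1" if "p < N * M" for p
      using ia(2) pdiv[OF that] by auto
    show "(\<lambda>t. gap_bound t / \<alpha> t powr \<delta>) \<longlonglongrightarrow> 0"
      using tendsto_mult_right_zero[OF iiia, of "\<Sum>i<N. \<Sum>j<N. a i j"] by (simp add: gap_bound_def)
    \<comment> \<open>Block \<open>k\<close> starts at \<open>k * h\<close>, and
      \<open>\<F> (k * h)\<close> is the sigma-algebra F(kh-1) on which condition (ii.c)
      conditions.\<close>
    show "(lam + h * \<alpha>0 * \<delta>) * ms (k * h) \<le> (\<Sum>j<h. gain (k * h) (k * h + j))" for k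
      using iic(4) by (intro gain_sum_ge) (simp add: add.commute)
  qed (use ia delta iic in auto)
  then have "(\<lambda>t. ennreal (ms t / \<alpha> t powr (2 * \<delta>))) \<longlonglongrightarrow> ennreal 0" by (rule tendsto_ennrealI)
  moreover have "ennreal (ms t / \<alpha> t powr (2 * \<delta>)) = ennreal (ms t) / ennreal (\<alpha> t powr (2 * \<delta>))" for t
    using ia(1) ms_nonneg by (intro divide_ennreal[symmetric]) (auto simp: less_imp_neq[symmetric])
  ultimately show ?thesis by (simp add: nn_integral_error)
qed

end
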